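(* Let $h\in\mathbb{R}$, $\epsilon>0$, $\beta>0$ and consider Algorithm 1 (described in the context). Assume: (A1) $\sum_{t=1}^\infty p_t=\infty$; (A2) for every $\bm{x}\in\Omega$ and $\eta>0$ there exist $\bm{x}'\in\Omega$ and a cost $c_i$ such that $\mathrm{P}(\bm{S}(\bm{x}',c_i)\in\mathscr{N}(\bm{x};\eta))>0$, where $\mathscr{N}(\bm{x};\eta)=\{\bm{a}\in D:\|\bm{a}-\bm{x}\|<\eta\}$; (A3) for every $\bm{x}\in\Omega$, the kernel $k$ is continuous at $(\bm{x},\bm{x})$. Let $\delta\in(0,1)$ and let $T^*$ be the smallest positive integer satisfying $T^*>2\beta\sigma^2\epsilon^{-2}$. Let $\nu$ be a positive number such that $$\forall \bm{x}\in\Omega,\ \forall \bm{a}^{(T^* )}=(\bm{a}_1,\dots,\bm{a}_{T^*})\in\mathscr{N}(\bm{x};\nu)^{T^*}:\quad \big|\varsigma^2_{T^*}(\bm{x})-\varsigma^2_{\bm{a}^{(T^* )}}(\bm{x})\big|<\frac{\epsilon^2}{2\beta},$$ and define the positive probabilities $$\tilde p_{\bm{x}}=\sum_{\bm{a}\in\Omega}\sum_{i=1}^K\kappa_i\,\mathrm{P}\big(\bm{S}(\bm{a},c_i)\in\mathscr{N}(\bm{x};\nu)\big)\quad(\bm{x}\in\Omega),\qquad \tilde p^*=\min_{\bm{x}\in\Omega}\tilde p_{\bm{x}} .$$ Then there exist non-negative integers $0=N_0<N_1<\dots<N_{|\Omega|T^*}$ such that $$\prod_{t=N_{j-1}+1}^{N_j}(1-p_t\tilde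 p^* )<\frac{\delta}{|\Omega|T^*}\qquad\text{for all } j\in\{1,\dots,|\Omega|T^*\}.$$ Moreover, for such integers, with probability at least $1-\delta$, Algorithm 1 completes after at most $N_{|\Omega|T^*}$ trials.
   Context: Setting. $D\subset\mathbb{R}^d$, $\Omega\subset D$ is a nonempty finite set, and $f:D\to\mathbb{R}$ is a black-box function modelled with a Gaussian process prior $\mathcal{GP}(0,k)$ with positive-definite kernel $k:D\times D\to\mathbb{R}$. There are costs $0<c_1<\dots<c_K$. If the point $\bm{x}\in\Omega$ is requested with cost $c_i$, the point actually evaluated is a random sample $\bm{s}\in D$ of a random variable $\bm{S}(\bm{x},c_i)$ with density $g(\cdot\mid\theta_{\bm{x}}^{(c_i)})$, and one observes $\bm{s}$ and $y=f(\bm{s})+\varrho$ with independent noise $\varrho\sim\mathcal{N}(0,\sigma^2)$, $\sigma^2>0$. Posterior. After $t$ trials with evaluated points $\bm{s}_1,\dots,\bm{s}_t$ and observations $\bm{y}_t=(y_1,\dots,y_t)^\top$, put $\bm{k}_t(\bm{x})=(k(\bm{s}_1,\bm{x}),\dots,k(\bm{s}_t,\bm{x}))^\top$, $\bm{K}_t=(k(\bm{s}_i,\bm{s}_j))_{i,j}$, $\bm{C}_t=\bm{K}_t+\sigma^2\bm{I}_t$, and $\mu_t(\bm{x})=\bm{k}_t(\bm{x})^\top\bm{C}_t^{-1}\bm{y}_t$, $k_t(\bm{x},\bm{x}')=k(\bm{x},\bm{x}')-\bm{k}_t(\bm{x})^\top\bm{C}_t^{-1}\bm{k}_t(\bm{x}')$,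 $\sigma_t^2(\bm{x})=k_t(\bm{x},\bm{x})$. (If a finite, possibly empty, set of initial training data from the same observation model is supplied, it is included in the conditioning as well.) Classification. Let $l_t(\bm{x})=\mu_t(\bm{x})-\beta^{1/2}\sigma_t(\bm{x})$, $u_t(\bm{x})=\mu_t(\bm{x})+\beta^{1/2}\sigma_t(\bm{x})$, and $H_t=\{\bm{x}\in\Omega: l_t(\bm{x})>h-\epsilon\}$, $L_t=\{\bm{x}\in\Omega: u_t(\bm{x})<h+\epsilon\}$, $U_t=\Omega\setminus(H_t\cup L_t)$ for $t\ge1$, with $U_0=\Omega$. Acquisition function. For a hypothetical new data point $(\bm{s}^*,y^* )$, let $HL_t(\bm{s}^*,y^* )$ be the union of the two estimated sets recomputed after adding $(\bm{s}^*,y^* )$ to the current data, let $HL_t=H_t\cup L_t$, and $a_t(\bm{x},c_i)=c_i^{-1}\big\{\int \mathrm{E}_{y^*}\big[|HL_t(\bm{s}^*,y^* )|\big]\,g(\bm{s}^*\mid\theta_{\bm{x}}^{(c_i)})\,d\bm{s}^*-|HL_t|\big\}$, where $y^*\sim\mathcal{N}(\mu_t(\bm{s}^* ),\sigma_t^2(\bm{s}^* )+\sigma^2)$. Algorithm 1. Given $p_1,p_2,\dots\in[0,1]$ and $\kappa_1,\dots,\kappa_K\in(0,1)$ with $|\Omega|\sum_{i=1}^K\kappa_i=1$. As long as $U_{t-1}\neq\emptyset$, trial $t$ is performed: draw independently $r_t\sim$ Bernoulli$(p_t)$; if $r_t=0$ choose $(\bm{x}_t,c_{i_t})$ maximizing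 the acquisition function (computed from the current data) over $\Omega\times\{c_1,\dots,c_K\}$; if $r_t=1$ draw $(\bm{x}_t,c_{i_t})=C_t$, where, independently of everything else, $\mathrm{P}(C_t=(\bm{x},c_i))=\kappa_i$ for each $\bm{x}\in\Omega$ and each $i$. Then sample $\bm{s}_t$ from $\bm{S}(\bm{x}_t,c_{i_t})$ (independently of the past given $(\bm{x}_t,c_{i_t})$), observe $y_t=f(\bm{s}_t)+\varrho_t$, and update. The algorithm completes after $t$ trials if $t$ is the first index with $U_t=\emptyset$. Auxiliary variances. For $t\ge1$ and $\bm{x}\in\Omega$, with $\bm{1}_t$ the all-ones vector, $\varsigma_t^2(\bm{x})=k(\bm{x},\bm{x})-(k(\bm{x},\bm{x})\bm{1}_t)^\top\big(k(\bm{x},\bm{x})\bm{1}_t\bm{1}_t^\top+\sigma^2\bm{I}_t\big)^{-1}(k(\bm{x},\bm{x})\bm{1}_t)$. For a tuple $\bm{x}^{(t)}=(\bm{x}_1,\dots,\bm{x}_t)$ of points of $D$, $\varsigma^2_{\bm{x}^{(t)}}(\bm{x})=k(\bm{x},\bm{x})-\bm{k}_{\bm{x}^{(t)}}(\bm{x})^\top(\bm{K}_{\bm{x}^{(t)}}+\sigma^2\bm{I}_t)^{-1}\bm{k}_{\bm{x}^{(t)}}(\bm{x})$, where $\bm{k}_{\bm{x}^{(t)}}(\bm{x})$ has $i$th entry $k(\bm{x}_i,\bm{x})$ and $\bm{K}_{\bm{x}^{(t)}}$ has $(i,j)$ entry $k(\bm{x}_i,\bm{x}_j)$. *)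

theory Defs
  imports
    "HOL-Probability.Probability"
    "Jordan_Normal_Form.Gauss_Jordan_Elimination"
begin

section \<open>Gaussian process posterior\<close>

text \<open>As usual for covariance kernels, positive definiteness of \<open>k\<close> means that all Gram matrices
  are positive semidefinite; singular Gram matrices are allowed.\<close>

definition pd_kernel_on :: "'a set \<Rightarrow> ('a \<Rightarrow> 'a \<Rightarrow> real) \<Rightarrow> bool" where
  "pd_kernel_on D k \<longleftrightarrow>
     (\<forall>a\<in>D. \<forall>b\<in>D. k a b = k b a) \<and>
     (\<forall>n. \<forall>z :: nat \<Rightarrow> 'a. \<forall>w :: nat \<Rightarrow> real. (\<forall>i<n. z i \<in> D) \<longrightarrow>
        0 \<le> (\<Sum>i<n. \<Sum>j<n. w i * w j * k (z i) (z j)))"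

definition kvec :: "('a \<Rightarrow> 'a \<Rightarrow> real) \<Rightarrow> 'a list \<Rightarrow> 'a \<Rightarrow> real Matrix.vec" where
  "kvec k ss x = Matrix.vec (length ss) (\<lambda>i. k (ss ! i) x)"

definition kmat :: "('a \<Rightarrow> 'a \<Rightarrow> real) \<Rightarrow> 'a list \<Rightarrow> real Matrix.mat" where
  "kmat k ss = Matrix.mat (length ss) (length ss) (\<lambda>(i, j). k (ss ! i) (ss ! j))"

text \<open>\<open>reg_form v A b b'\<close> is \<open>b\<^sup>T (A + v I)\<^sup>-\<^sup>1 b'\<close>. The inverse exists in all uses below: there
  \<open>A\<close> is positive semidefinite and \<open>v > 0\<close>. For dimension \<open>0\<close> (no data) the value is \<open>0\<close>.\<close>

definition reg_form :: "real \<Rightarrow> real Matrix.mat \<Rightarrow> real Matrix.vec \<Rightarrow> real Matrix.vec \<Rightarrow> real" where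
  "reg_form v A b b' =
     scalar_prod b (mult_mat_vec (the (mat_inverse (A + smult_mat v (one_mat (dim_row A))))) b')"

text \<open>Data are lists of pairs of an evaluated point and an observation. The parameter \<open>\<sigma>\<close> is the
  standard deviation of the noise.\<close>

definition post_mean :: "('a \<Rightarrow> 'a \<Rightarrow> real) \<Rightarrow> real \<Rightarrow> ('a \<times> real) list \<Rightarrow> 'a \<Rightarrow> real" where
  "post_mean k \<sigma> dat x =
     reg_form (\<sigma>\<^sup>2) (kmat k (map fst dat)) (kvec k (map fst dat) x) (vec_of_list (map snd dat))"

definition post_cov :: "('a \<Rightarrow> 'a \<Rightarrow> real) \<Rightarrow> real \<Rightarrow> 'a list \<Rightarrow> 'a \<Rightarrow> 'a \<Rightarrow> real" where
  "post_cov k \<sigma> ss x x' = k x x' - reg_form (\<sigma>\<^sup>2) (kmat k ss) (kvec k ss x) (kvec k ss x')"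

definition post_var :: "('a \<Rightarrow> 'a \<Rightarrow> real) \<Rightarrow> real \<Rightarrow> 'a list \<Rightarrow> 'a \<Rightarrow> real" where
  "post_var k \<sigma> ss x = post_cov k \<sigma> ss x x"

text \<open>The auxiliary variance \<open>\<varsigma>\<^sub>t\<^sup>2(x)\<close>; the one for a tuple of points is \<open>post_var\<close>.\<close>

definition varsigma2 :: "('a \<Rightarrow> 'a \<Rightarrow> real) \<Rightarrow> real \<Rightarrow> nat \<Rightarrow> 'a \<Rightarrow> real" where
  "varsigma2 k \<sigma> t x =
     k x x - reg_form (\<sigma>\<^sup>2) (Matrix.mat t t (\<lambda>_. k x x))
       (Matrix.vec t (\<lambda>_. k x x)) (Matrix.vec t (\<lambda>_. k x x))"

section \<open>Classification and acquisition function\<close>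

definition lcb :: "('a \<Rightarrow> 'a \<Rightarrow> real) \<Rightarrow> real \<Rightarrow> real \<Rightarrow> ('a \<times> real) list \<Rightarrow> 'a \<Rightarrow> real" where
  "lcb k \<sigma> \<beta> dat x = post_mean k \<sigma> dat x - sqrt \<beta> * sqrt (post_var k \<sigma> (map fst dat) x)"

definition ucb :: "('a \<Rightarrow> 'a \<Rightarrow> real) \<Rightarrow> real \<Rightarrow> real \<Rightarrow> ('a \<times> real) list \<Rightarrow> 'a \<Rightarrow> real" where
  "ucb k \<sigma> \<beta> dat x = post_mean k \<sigma> dat x + sqrt \<beta> * sqrt (post_var k \<sigma> (map fst dat) x)"

definition H_set ::
  "('a \<Rightarrow> 'a \<Rightarrow> real) \<Rightarrow> real \<Rightarrow> real \<Rightarrow> real \<Rightarrow> real \<Rightarrow> 'a set \<Rightarrow> ('a \<times> real) list \<Rightarrow> 'a set" where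
  "H_set k \<sigma> \<beta> h \<epsilon> \<Omega> dat = {x \<in> \<Omega>. lcb k \<sigma> \<beta> dat x > h - \<epsilon>}"

definition L_set ::
  "('a \<Rightarrow> 'a \<Rightarrow> real) \<Rightarrow> real \<Rightarrow> real \<Rightarrow> real \<Rightarrow> real \<Rightarrow> 'a set \<Rightarrow> ('a \<times> real) list \<Rightarrow> 'a set" where
  "L_set k \<sigma> \<beta> h \<epsilon> \<Omega> dat = {x \<in> \<Omega>. ucb k \<sigma> \<beta> dat x < h + \<epsilon>}"

definition HL_set ::
  "('a \<Rightarrow> 'a \<Rightarrow> real) \<Rightarrow> real \<Rightarrow> real \<Rightarrow> real \<Rightarrow> real \<Rightarrow> 'a set \<Rightarrow> ('a \<times> real) list \<Rightarrow> 'a set" where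
  "HL_set k \<sigma> \<beta> h \<epsilon> \<Omega> dat = H_set k \<sigma> \<beta> h \<epsilon> \<Omega> dat \<union> L_set k \<sigma> \<beta> h \<epsilon> \<Omega> dat"

text \<open>The law of a random variable with Lebesgue density \<open>g q\<close>, where \<open>q\<close> is the parameter of the
  density.\<close>

definition S_law :: "('q \<Rightarrow> 'a::euclidean_space \<Rightarrow> real) \<Rightarrow> 'q \<Rightarrow> 'a measure" where
  "S_law g q = density lborel (\<lambda>s. ennreal (g q s))"

text \<open>The argument \<open>HL\<close> is the current set of classified points. It is separate from \<open>dat\<close> because
  before the first trial nothing counts as classified (\<open>U\<^sub>0 = \<Omega>\<close>), whatever the initial data.\<close>

definition acq ::
  "('a::euclidean_space \<Rightarrow> 'a \<Rightarrow> real) \<Rightarrow> real \<Rightarrow> real \<Rightarrow> real \<Rightarrow> real \<Rightarrow> 'a set \<Rightarrow>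
   ('q \<Rightarrow> 'a \<Rightarrow> real) \<Rightarrow> ('a \<Rightarrow> real \<Rightarrow> 'q) \<Rightarrow>
   ('a \<times> real) list \<Rightarrow> 'a set \<Rightarrow> 'a \<Rightarrow> real \<Rightarrow> real" where
  "acq k \<sigma> \<beta> h \<epsilon> \<Omega> g \<theta> dat HL x cost =
     inverse cost *
       ((\<integral>s. (\<integral>y. real (card (HL_set k \<sigma> \<beta> h \<epsilon> \<Omega> (dat @ [(s, y)])))
               \<partial>density lborel (\<lambda>y. ennreal (normal_density (post_mean k \<sigma> dat s)
                  (sqrt (post_var k \<sigma> (map fst dat) s + \<sigma>\<^sup>2)) y)))
             * g (\<theta> x cost) s \<partial>lborel)
        - real (card HL))"

section \<open>The model and the algorithm\<close>

definition nbhd :: "'a::euclidean_space set \<Rightarrow> 'a \<Rightarrow> real \<Rightarrow> 'a set" where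
  "nbhd D x \<eta> = {a \<in> D. norm (a - x) < \<eta>}"

definition p_tilde ::
  "'a::euclidean_space set \<Rightarrow> 'a set \<Rightarrow> nat \<Rightarrow> (nat \<Rightarrow> real) \<Rightarrow> ('q \<Rightarrow> 'a \<Rightarrow> real) \<Rightarrow>
   ('a \<Rightarrow> real \<Rightarrow> 'q) \<Rightarrow> (nat \<Rightarrow> real) \<Rightarrow> real \<Rightarrow> 'a \<Rightarrow> real" where
  "p_tilde D \<Omega> K c g \<theta> \<kappa> \<nu> x =
     (\<Sum>a\<in>\<Omega>. \<Sum>i=1..K. \<kappa> i * measure (S_law g (\<theta> a (c i))) (nbhd D x \<nu>))"

text \<open>Functions on \<open>D\<close> are total functions of which only the values on \<open>D\<close> matter. Measurability of
  \<open>D\<close>, \<open>f\<close> and \<open>k\<close> is what makes the probabilities and integrals below meaningful.\<close>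

locale lse_model =
  fixes D \<Omega> :: "'a::euclidean_space set"
    and f :: "'a \<Rightarrow> real"
    and k :: "'a \<Rightarrow> 'a \<Rightarrow> real"
    and \<sigma> :: real
    and K :: nat
    and c :: "nat \<Rightarrow> real"
    and g :: "'q \<Rightarrow> 'a \<Rightarrow> real"
    and \<theta> :: "'a \<Rightarrow> real \<Rightarrow> 'q"
  assumes D_borel: "D \<in> sets borel"
    and Omega: "finite \<Omega>" "\<Omega> \<noteq> {}" "\<Omega> \<subseteq> D"
    and f_borel: "f \<in> borel_measurable (restrict_space borel D)"
    and k_borel: "(\<lambda>(a, b). k a b) \<in>
      borel_measurable (restrict_space borel D \<Otimes>\<^sub>M restrict_space borel D)"
    and k_pd: "pd_kernel_on D k"
    and sigma_pos: "\<sigma> > 0"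
    and costs: "1 \<le> K" "0 < c 1" "strict_mono_on {1..K} c"
    and g_density: "\<And>x i. x \<in> \<Omega> \<Longrightarrow> i \<in> {1..K} \<Longrightarrow>
      g (\<theta> x (c i)) \<in> borel_measurable borel \<and> (\<forall>s. 0 \<le> g (\<theta> x (c i)) s) \<and>
      prob_space (S_law g (\<theta> x (c i))) \<and> (AE s in S_law g (\<theta> x (c i)). s \<in> D)"

text \<open>A run of the algorithm on a probability space \<open>M\<close>.

  \<^item> \<open>F t\<close> is the information after trial \<open>t\<close>; \<open>G t\<close> is the information during trial \<open>t\<close>, when the
    point and cost \<open>sel t = (x\<^sub>t, i\<^sub>t)\<close> have been chosen but \<open>s t\<close> and the noise \<open>e t\<close> have not been
    drawn. They may contain more than the history of the run, e.g. random breaking of ties.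
  \<^item> \<open>s0\<close> and \<open>e0\<close> give the \<open>n0\<close> initial points and their noise.
  \<^item> \<open>performed t\<close> is the event that trial \<open>t\<close> takes place. The values of the processes at later
    times are meaningless, so all distributional assumptions are restricted to this event.
  \<^item> Assumption \<open>draw\<close> says that on this event \<open>r t\<close> and \<open>C t\<close> have the prescribed laws and that
    they are independent of each other and of the past; \<open>sample\<close> and \<open>noise\<close> are to be read
    in the same way.\<close>

definition performed :: "'w measure \<Rightarrow> (nat \<Rightarrow> 'w \<Rightarrow> 'a set) \<Rightarrow> nat \<Rightarrow> 'w set" where
  "performed M U t = {\<omega> \<in> space M. \<forall>j<t. U j \<omega> \<noteq> {}}"

locale lse_run = lse_model D \<Omega> f k \<sigma> K c g \<theta> + prob_space M + filtration "space M" F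
  for D \<Omega> :: "'a::euclidean_space set"
    and f :: "'a \<Rightarrow> real"
    and k :: "'a \<Rightarrow> 'a \<Rightarrow> real"
    and \<sigma> :: real
    and K :: nat
    and c :: "nat \<Rightarrow> real"
    and g :: "'q \<Rightarrow> 'a \<Rightarrow> real"
    and \<theta> :: "'a \<Rightarrow> real \<Rightarrow> 'q"
    and M :: "'w measure"
    and F :: "nat \<Rightarrow> 'w measure" +
  fixes G :: "nat \<Rightarrow> 'w measure"
    and h \<epsilon> \<beta> :: real
    and p :: "nat \<Rightarrow> real"
    and \<kappa> :: "nat \<Rightarrow> real"
    and n0 :: nat
    and s0 :: "nat \<Rightarrow> 'w \<Rightarrow> 'a"
    and e0 :: "nat \<Rightarrow> 'w \<Rightarrow> real"
    and r :: "nat \<Rightarrow> 'w \<Rightarrow> bool"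
    and C :: "nat \<Rightarrow> 'w \<Rightarrow> 'a \<times> nat"
    and sel :: "nat \<Rightarrow> 'w \<Rightarrow> 'a \<times> nat"
    and s :: "nat \<Rightarrow> 'w \<Rightarrow> 'a"
    and e :: "nat \<Rightarrow> 'w \<Rightarrow> real"
    and dat :: "nat \<Rightarrow> 'w \<Rightarrow> ('a \<times> real) list"
    and U :: "nat \<Rightarrow> 'w \<Rightarrow> 'a set"
  assumes p_range: "\<And>t. 1 \<le> t \<Longrightarrow> p t \<in> {0..1}"
    and kappa_range: "\<And>i. i \<in> {1..K} \<Longrightarrow> \<kappa> i \<in> {0<..<1}"
    and kappa_sum: "real (card \<Omega>) * (\<Sum>i=1..K. \<kappa> i) = 1"
    and F_sub: "\<And>t. subalgebra M (F t)"
    and G_sub: "\<And>t. 1 \<le> t \<Longrightarrow> subalgebra (G t) (F (t - 1)) \<and> subalgebra (F t) (G t)"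
    and initial_adapted: "\<And>j. j < n0 \<Longrightarrow>
      s0 j \<in> F 0 \<rightarrow>\<^sub>M restrict_space borel D \<and> e0 j \<in> borel_measurable (F 0)"
    and initial_noise: "\<And>j. j < n0 \<Longrightarrow>
      distributed M lborel (e0 j) (\<lambda>z. ennreal (normal_density 0 \<sigma> z)) \<and>
      indep_set (sets (vimage_algebra (space M) (e0 j) borel))
        (sets (vimage_algebra (space M) (\<lambda>\<omega>. (\<lambda>i\<in>{..j}. s0 i \<omega>, \<lambda>i\<in>{..<j}. e0 i \<omega>))
          ((\<Pi>\<^sub>M i\<in>{..j}. borel) \<Otimes>\<^sub>M (\<Pi>\<^sub>M i\<in>{..<j}. borel))))"
    and adapted: "\<And>t. 1 \<le> t \<Longrightarrow>
      r t \<in> G t \<rightarrow>\<^sub>M count_space UNIV \<and>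
      C t \<in> G t \<rightarrow>\<^sub>M count_space (\<Omega> \<times> {1..K}) \<and>
      sel t \<in> G t \<rightarrow>\<^sub>M count_space (\<Omega> \<times> {1..K}) \<and>
      s t \<in> F t \<rightarrow>\<^sub>M restrict_space borel D \<and>
      e t \<in> borel_measurable (F t)"
    and dat_0: "\<And>\<omega>. \<omega> \<in> space M \<Longrightarrow>
      dat 0 \<omega> = map (\<lambda>j. (s0 j \<omega>, f (s0 j \<omega>) + e0 j \<omega>)) [0..<n0]"
    and dat_Suc: "\<And>t \<omega>. \<omega> \<in> space M \<Longrightarrow>
      dat (Suc t) \<omega> = dat t \<omega> @ [(s (Suc t) \<omega>, f (s (Suc t) \<omega>) + e (Suc t) \<omega>)]"
    and U_0: "\<And>\<omega>. \<omega> \<in> space M \<Longrightarrow> U 0 \<omega> = \<Omega>"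
    and U_pos: "\<And>t \<omega>. \<omega> \<in> space M \<Longrightarrow> 1 \<le> t \<Longrightarrow>
      U t \<omega> = \<Omega> - HL_set k \<sigma> \<beta> h \<epsilon> \<Omega> (dat t \<omega>)"
    and draw: "\<And>t E b a i. 1 \<le> t \<Longrightarrow> E \<in> sets (F (t - 1)) \<Longrightarrow> E \<subseteq> performed M U t \<Longrightarrow>
      a \<in> \<Omega> \<Longrightarrow> i \<in> {1..K} \<Longrightarrow>
      prob {\<omega> \<in> E. r t \<omega> = b \<and> C t \<omega> = (a, i)} = prob E * pmf (bernoulli_pmf (p t)) b * \<kappa> i"
    and exploit: "\<And>t \<omega>. 1 \<le> t \<Longrightarrow> \<omega> \<in> performed M U t \<Longrightarrow> \<not> r t \<omega> \<Longrightarrow>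
      is_arg_max
        (\<lambda>(a, i). acq k \<sigma> \<beta> h \<epsilon> \<Omega> g \<theta> (dat (t - 1) \<omega>) (\<Omega> - U (t - 1) \<omega>) a (c i))
        (\<lambda>q. q \<in> \<Omega> \<times> {1..K}) (sel t \<omega>)"
    and explore: "\<And>t \<omega>. 1 \<le> t \<Longrightarrow> \<omega> \<in> performed M U t \<Longrightarrow> r t \<omega> \<Longrightarrow> sel t \<omega> = C t \<omega>"
    and sample: "\<And>t E a i A. 1 \<le> t \<Longrightarrow> E \<in> sets (G t) \<Longrightarrow> E \<subseteq> performed M U t \<Longrightarrow>
      a \<in> \<Omega> \<Longrightarrow> i \<in> {1..K} \<Longrightarrow> A \<in> sets borel \<Longrightarrow>
      prob {\<omega> \<in> E. sel t \<omega> = (a, i) \<and> s t \<omega> \<in> A} =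
        prob {\<omega> \<in> E. sel t \<omega> = (a, i)} * measure (S_law g (\<theta> a (c i))) A"
    and noise: "\<And>t E A B. 1 \<le> t \<Longrightarrow> E \<in> sets (G t) \<Longrightarrow> E \<subseteq> performed M U t \<Longrightarrow>
      A \<in> sets borel \<Longrightarrow> B \<in> sets borel \<Longrightarrow>
      prob {\<omega> \<in> E. s t \<omega> \<in> A \<and> e t \<omega> \<in> B} =
        prob {\<omega> \<in> E. s t \<omega> \<in> A} *
        measure (density lborel (\<lambda>z. ennreal (normal_density 0 \<sigma> z))) B"

definition completes_after :: "(nat \<Rightarrow> 'w \<Rightarrow> 'a set) \<Rightarrow> nat \<Rightarrow> 'w \<Rightarrow> bool" where
  "completes_after U t \<omega> \<longleftrightarrow> U t \<omega> = {} \<and> (\<forall>j<t. U j \<omega> \<noteq> {})"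

text \<open>\<open>N 0, \<dots>, N J\<close> split the trials into \<open>J\<close> consecutive blocks.\<close>

definition admissible_blocks ::
  "(nat \<Rightarrow> real) \<Rightarrow> real \<Rightarrow> real \<Rightarrow> nat \<Rightarrow> (nat \<Rightarrow> nat) \<Rightarrow> bool" where
  "admissible_blocks p pstar \<delta> J N \<longleftrightarrow>
     N 0 = 0 \<and> (\<forall>j\<in>{1..J}. N (j - 1) < N j) \<and>
     (\<forall>j\<in>{1..J}. (\<Prod>t\<in>{N (j - 1) + 1..N j}. 1 - p t * pstar) < \<delta> / real J)"

end

theory Submission
  imports Defs "Jordan_Normal_Form.Determinant"
begin

text \<open>The posterior variance is the minimum over weights \<open>w\<close> of a quadratic function of \<open>w\<close>; padding
  weights by zeros shows that it does not increase when data are added, in any order, and constant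
  weights \<open>1 / t\<close> give \<open>\<varsigma>\<^sub>t\<^sup>2(x) \<le> \<sigma>\<^sup>2 / t\<close>. Hence a point \<open>x\<close> with \<open>T\<close> evaluations in its
  \<open>\<nu>\<close>-neighbourhood has posterior variance below \<open>\<epsilon>\<^sup>2 / \<beta>\<close>, so its credible interval has half-width
  below \<open>\<epsilon>\<close> and it is classified whatever the observations are.

  While the algorithm runs, trial \<open>t\<close> hits this neighbourhood with conditional probability at least
  \<open>p\<^sub>t\<close> times the target probability, because exploration alone does so. Assign \<open>T\<close> blocks of
  trials to each point of \<open>\<Omega>\<close>: a block is performed completely without a hit of its point with
  probability less than \<open>\<delta>\<close> divided by the number of blocks, and a union bound finishes the
  proof.\<close>

section \<open>Posterior variance as a minimum\<close>

lemma reg_mat_mult_vec_index: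
  fixes a :: "nat \<Rightarrow> nat \<Rightarrow> real"
  assumes "x \<in> carrier_vec n" "i < n"
  shows "vec_index ((Matrix.mat n n (\<lambda>(i, j). a i j) + smult_mat v (one_mat n)) *\<^sub>v x) i
    = (\<Sum>j<n. a i j * vec_index x j) + v * vec_index x i"
proof -
  have "vec_index ((Matrix.mat n n (\<lambda>(i, j). a i j) + smult_mat v (one_mat n)) *\<^sub>v x) i
      = (\<Sum>j<n. (a i j + (if i = j then v else 0)) * vec_index x j)"
    using assms by (simp add: scalar_prod_def atLeast0LessThan) (rule sum.cong, auto)
  also have "\<dots> = (\<Sum>j<n. a i j * vec_index x j + (if i = j then v * vec_index x j else 0))"
    by (rule sum.cong) (auto simp: distrib_right)
  also have "\<dots> = (\<Sum>j<n. a i j * vec_index x j) + v * vec_index x i"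
    using assms by (simp add: sum.distrib)
  finally show ?thesis .
qed

text \<open>A vector z with B z = 0 gives 0 = z^T A z + v |z|^2 with both terms nonnegative; since v
  > 0, this forces z = 0.\<close>

lemma reg_mat_det_nonzero:
  fixes a :: "nat \<Rightarrow> nat \<Rightarrow> real"
  assumes psd: "\<And>w. 0 \<le> (\<Sum>i<n. \<Sum>j<n. w i * w j * a i j)" and v: "v > 0"
  defines "B \<equiv> Matrix.mat n n (\<lambda>(i, j). a i j) + smult_mat v (one_mat n)"
  shows "Determinant.det B \<noteq> 0"
proof
  have B: "B \<in> carrier_mat n n"
    unfolding B_def by simp
  assume "Determinant.det B = 0"
  then obtain x where x: "x \<in> carrier_vec n" "x \<noteq> 0\<^sub>v n" "B *\<^sub>v x = 0\<^sub>v n"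
    using det_0_iff_vec_prod_zero_field[OF B] by blast
  define z where "z i = vec_index x i" for i
  have row: "(\<Sum>j<n. a i j * z j) + v * z i = 0" if "i < n" for i
    using reg_mat_mult_vec_index[OF x(1) that, of a v] x(3) that unfolding z_def B_def by simp
  have "0 = (\<Sum>i<n. z i * ((\<Sum>j<n. a i j * z j) + v * z i))"
    using row by simp
  also have "\<dots> = (\<Sum>i<n. \<Sum>j<n. z i * z j * a i j) + v * (\<Sum>i<n. (z i)\<^sup>2)"
    by (simp add: distrib_left sum.distrib sum_distrib_left mult_ac power2_eq_square)
  finally have "v * (\<Sum>i<n. (z i)\<^sup>2) \<le> 0"
    using psd[of z] by linarith
  then have "(\<Sum>i<n. (z i)\<^sup>2) = 0"
    using v by (meson mult_le_0_iff not_le order_antisym sum_nonneg zero_le_power2)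
  then have "\<forall>i<n. z i = 0"
    by (subst (asm) sum_nonneg_eq_0_iff) auto
  then show False
    using x by (auto simp: z_def)
qed

text \<open>Multiplying the identity for \<open>B * adj_mat B\<close> by the inverse from the left
  identifies the output of the elimination procedure \<open>mat_inverse\<close> with the adjugate
  formula. The inverse is thus a rational function of the entries, which measurability relies
  on.\<close>

lemma mat_inverse_eq_adj:
  fixes B :: "real Matrix.mat"
  assumes B: "B \<in> carrier_mat n n" and det: "Determinant.det B \<noteq> 0"
  obtains X where "mat_inverse B = Some X" "X \<in> carrier_mat n n" "B * X = 1\<^sub>m n"
    "X = (1 / Determinant.det B) \<cdot>\<^sub>m adj_mat B"
proof -
  have "B \<in> Units (ring_mat TYPE(real) n ())"
    using det_non_zero_imp_unit[OF B det] .
  then obtain X where X: "mat_inverse B = Some X"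
    using mat_inverse(1)[OF B, of "()"] by (cases "mat_inverse B") auto
  note inv = mat_inverse(2)[OF B X]
  have "adj_mat B = (X * B) * adj_mat B"
    using inv adj_mat(1)[OF B] by simp
  also have "\<dots> = X * (B * adj_mat B)"
    using inv adj_mat(1)[OF B] B by (intro assoc_mult_mat) auto
  also have "\<dots> = Determinant.det B \<cdot>\<^sub>m X"
    using inv by (auto simp: adj_mat(2)[OF B] mult_smult_distrib[of X n n "1\<^sub>m n" n])
  finally have "X = (1 / Determinant.det B) \<cdot>\<^sub>m adj_mat B"
    using det inv by (auto intro!: eq_matI)
  then show thesis using that X inv by blast
qed

text \<open>The witness z is (A + v I)^-1 b. The extremal argument can then use the linear system
  solved by z, written with finite sums, instead of an inverse matrix.\<close>

lemma reg_form_normal_equations: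
  fixes a :: "nat \<Rightarrow> nat \<Rightarrow> real"
  assumes psd: "\<And>w. 0 \<le> (\<Sum>i<n. \<Sum>j<n. w i * w j * a i j)" and v: "v > 0"
  shows "\<exists>z.
    reg_form v (Matrix.mat n n (\<lambda>(i, j). a i j)) (Matrix.vec n b) (Matrix.vec n b) = (\<Sum>i<n. b i * z i) \<and>
    (\<forall>i<n. (\<Sum>j<n. a i j * z j) + v * z i = b i)"
proof -
  define B where "B = Matrix.mat n n (\<lambda>(i, j). a i j) + smult_mat v (one_mat n)"
  have B: "B \<in> carrier_mat n n"
    unfolding B_def by simp
  have "Determinant.det B \<noteq> 0"
    unfolding B_def using psd v by (rule reg_mat_det_nonzero)
  then obtain X where X: "mat_inverse B = Some X" "X \<in> carrier_mat n n" "B * X = 1\<^sub>m n"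
    using mat_inverse_eq_adj[OF B] by blast
  define x where "x = X *\<^sub>v Matrix.vec n b"
  have x: "x \<in> carrier_vec n" using X unfolding x_def by simp
  define z where "z i = vec_index x i" for i
  have Bx: "B *\<^sub>v x = Matrix.vec n b"
    unfolding x_def using X B by (subst assoc_mult_mat_vec[symmetric]) auto
  have "(\<Sum>j<n. a i j * z j) + v * z i = b i" if "i < n" for i
    using reg_mat_mult_vec_index[OF x that, of a v] Bx that unfolding z_def B_def by simp
  moreover have "reg_form v (Matrix.mat n n (\<lambda>(i, j). a i j)) (Matrix.vec n b) (Matrix.vec n b)
      = (\<Sum>i<n. b i * z i)"
    using X(1) x unfolding reg_form_def z_def B_def[symmetric]
    by (simp add: B_def[symmetric] x_def[symmetric] scalar_prod_def atLeast0LessThan)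
  ultimately show ?thesis by blast
qed

text \<open>This is 2 w^T b - w^T (A + v I) w. For the Gram matrix A and the kernel vector b at x,
  subtracting it from \<open>k x x\<close> gives the mean squared error of the w-weighted sum of
  noisy observations as a predictor of f(x) under the prior.\<close>

definition reg_obj :: "real \<Rightarrow> nat \<Rightarrow> (nat \<Rightarrow> nat \<Rightarrow> real) \<Rightarrow> (nat \<Rightarrow> real) \<Rightarrow> (nat \<Rightarrow> real) \<Rightarrow> real" where
  "reg_obj v n a b w =
     2 * (\<Sum>i<n. w i * b i) - (\<Sum>i<n. \<Sum>j<n. w i * w j * a i j) - v * (\<Sum>i<n. (w i)\<^sup>2)"

text \<open>Completing the square: if z solves the normal equations, R minus the objective at w
  equals (w - z)^T (A + v I) (w - z), which is nonnegative and vanishes at w = z.\<close>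

lemma reg_form_is_max:
  fixes a :: "nat \<Rightarrow> nat \<Rightarrow> real" and b :: "nat \<Rightarrow> real"
  assumes psd: "\<And>w. 0 \<le> (\<Sum>i<n. \<Sum>j<n. w i * w j * a i j)" and v: "v > 0"
    and sym: "\<And>i j. i < n \<Longrightarrow> j < n \<Longrightarrow> a i j = a j i"
  defines "R \<equiv> reg_form v (Matrix.mat n n (\<lambda>(i, j). a i j)) (Matrix.vec n b) (Matrix.vec n b)"
  shows "reg_obj v n a b w \<le> R" and "\<exists>z. reg_obj v n a b z = R"
proof -
  obtain z where R: "R = (\<Sum>i<n. b i * z i)"
    and z: "\<And>i. i < n \<Longrightarrow> (\<Sum>j<n. a i j * z j) + v * z i = b i"
    using reg_form_normal_equations[OF psd v, of b] unfolding R_def by blast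
  \<comment> \<open>The normal equations tested against u; the cases u = w and u = z eliminate
    b.\<close>
  have ub: "(\<Sum>i<n. u i * b i) = (\<Sum>i<n. \<Sum>j<n. u i * z j * a i j) + v * (\<Sum>i<n. u i * z i)" for u
  proof -
    have "(\<Sum>i<n. u i * b i) = (\<Sum>i<n. u i * ((\<Sum>j<n. a i j * z j) + v * z i))"
      using z by simp
    then show ?thesis
      by (simp add: distrib_left sum.distrib sum_distrib_left mult_ac)
  qed
  have R': "R = (\<Sum>i<n. z i * b i)" unfolding R by (simp add: mult_ac)
  \<comment> \<open>Symmetry of a enters here: the two cross terms of the square coincide.\<close>
  have swap: "(\<Sum>i<n. \<Sum>j<n. z i * w j * a i j) = (\<Sum>i<n. \<Sum>j<n. w i * z j * a i j)"
    by (subst sum.swap) (auto intro!: sum.cong simp: sym mult_ac)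
  have "0 \<le> (\<Sum>i<n. \<Sum>j<n. (w i - z i) * (w j - z j) * a i j) + v * (\<Sum>i<n. (w i - z i)\<^sup>2)"
    using psd[of "\<lambda>i. w i - z i"] v by (simp add: sum_nonneg)
  also have "(\<Sum>i<n. \<Sum>j<n. (w i - z i) * (w j - z j) * a i j) =
     (\<Sum>i<n. \<Sum>j<n. w i * w j * a i j) + (\<Sum>i<n. \<Sum>j<n. z i * z j * a i j)
     - (\<Sum>i<n. \<Sum>j<n. w i * z j * a i j) - (\<Sum>i<n. \<Sum>j<n. z i * w j * a i j)"
    by (simp add: algebra_simps sum.distrib sum_subtractf)
  also have "(\<Sum>i<n. (w i - z i)\<^sup>2) = (\<Sum>i<n. (w i)\<^sup>2) + (\<Sum>i<n. z i * z i) - 2 * (\<Sum>i<n. w i * z i)"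
    by (simp add: algebra_simps power2_eq_square sum.distrib sum_subtractf sum_distrib_left)
  finally show "reg_obj v n a b w \<le> R"
    unfolding reg_obj_def R' ub swap by (simp add: algebra_simps)
  show "\<exists>z. reg_obj v n a b z = R"
    using ub[of z] by (intro exI[of _ z]) (simp add: reg_obj_def R' power2_eq_square)
qed

section \<open>Posterior variance under more data and at repeated points\<close>

lemma pd_kernel_on_sym: "pd_kernel_on D k \<Longrightarrow> a \<in> D \<Longrightarrow> b \<in> D \<Longrightarrow> k a b = k b a"
  unfolding pd_kernel_on_def by blast

lemma pd_kernel_on_psd:
  assumes "pd_kernel_on D k" "set ss \<subseteq> D"
  shows "0 \<le> (\<Sum>i<length ss. \<Sum>j<length ss. w i * w j * k (ss ! i) (ss ! j))"
  using assms unfolding pd_kernel_on_def by (auto simp: subset_iff)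

lemma post_var_is_min:
  fixes x :: 'a
  assumes pd: "pd_kernel_on D k" and ss: "set ss \<subseteq> D" and \<sigma>: "\<sigma> > 0"
  defines "Q \<equiv> reg_obj (\<sigma>\<^sup>2) (length ss) (\<lambda>i j. k (ss ! i) (ss ! j)) (\<lambda>i. k (ss ! i) x)"
  shows "post_var k \<sigma> ss x \<le> k x x - Q w" and "\<exists>z. post_var k \<sigma> ss x = k x x - Q z"
proof -
  note max = reg_form_is_max[where n = "length ss" and a = "\<lambda>i j. k (ss ! i) (ss ! j)" and v = "\<sigma>\<^sup>2" and b = "\<lambda>i. k (ss ! i) x"]
  have sym: "k (ss ! i) (ss ! j) = k (ss ! j) (ss ! i)" if "i < length ss" "j < length ss" for i j
    using pd_kernel_on_sym[OF pd] ss that by (meson nth_mem subsetD)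
  have \<sigma>2: "\<sigma>\<^sup>2 > 0" using \<sigma> by simp
  note max' = max[OF pd_kernel_on_psd[OF pd ss] \<sigma>2 sym]
  show "post_var k \<sigma> ss x \<le> k x x - Q w" "\<exists>z. post_var k \<sigma> ss x = k x x - Q z"
    using max'(1)[of w] max'(2)
    by (auto simp: post_var_def post_cov_def kmat_def kvec_def Q_def) metis
qed

text \<open>Weights for the subfamily, padded by zeros, are admissible weights for the whole family.\<close>

lemma post_var_subfamily_le:
  assumes pd: "pd_kernel_on D k" and ss: "set ss \<subseteq> D" and \<sigma>: "\<sigma> > 0"
    and idx: "inj_on idx {..<m}" "\<And>i. i < m \<Longrightarrow> idx i < length ss"
  shows "post_var k \<sigma> ss x \<le> post_var k \<sigma> (map (\<lambda>i. ss ! idx i) [0..<m]) x"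
proof -
  define as where "as = map (\<lambda>i. ss ! idx i) [0..<m]"
  have as: "set as \<subseteq> D" "length as = m" "\<And>i. i < m \<Longrightarrow> as ! i = ss ! idx i"
    using ss idx(2) unfolding as_def by (auto simp: subset_iff)
  obtain z where z: "post_var k \<sigma> as x =
      k x x - reg_obj (\<sigma>\<^sup>2) m (\<lambda>i j. k (as ! i) (as ! j)) (\<lambda>i. k (as ! i) x) z"
    using post_var_is_min(2)[OF pd as(1) \<sigma>, of x] as(2) by auto
  define n where "n = length ss"
  \<comment> \<open>The push-forward of z along \<open>idx\<close>, zero outside the range of
    \<open>idx\<close>.\<close>
  define w where "w l = (\<Sum>i<m. if idx i = l then z i else 0)" for l
  have w_sum: "(\<Sum>l<n. w l * \<phi> l) = (\<Sum>i<m. z i * \<phi> (idx i))" for \<phi> :: "nat \<Rightarrow> real"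
  proof -
    have "(\<Sum>l<n. w l * \<phi> l) = (\<Sum>i<m. \<Sum>l<n. (if idx i = l then z i * \<phi> l else 0))"
      unfolding w_def sum_distrib_right by (subst sum.swap) (auto intro!: sum.cong)
    also have "\<dots> = (\<Sum>i<m. z i * \<phi> (idx i))"
      using idx(2) by (auto intro!: sum.cong simp: n_def)
    finally show ?thesis .
  qed
  \<comment> \<open>Injectivity makes the penalty \<Sum> w^2 agree with \<Sum> z^2; with repeated
    indices the weights at one position would be added before being squared.\<close>
  have w_idx: "w (idx i) = z i" if "i < m" for i
  proof -
    have "w (idx i) = (\<Sum>j<m. if j = i then z j else 0)"
      unfolding w_def using idx(1) that by (intro sum.cong) (auto dest: inj_onD)
    then show ?thesis using that by simp
  qed
  have "reg_obj (\<sigma>\<^sup>2) n (\<lambda>i j. k (ss ! i) (ss ! j)) (\<lambda>i. k (ss ! i) x) w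
      = reg_obj (\<sigma>\<^sup>2) m (\<lambda>i j. k (as ! i) (as ! j)) (\<lambda>i. k (as ! i) x) z"
  proof -
    have 1: "(\<Sum>l<n. (w l)\<^sup>2) = (\<Sum>i<m. (z i)\<^sup>2)"
      using w_sum[of w] w_idx by (simp add: power2_eq_square)
    have "(\<Sum>l<n. \<Sum>l'<n. w l * w l' * k (ss ! l) (ss ! l'))
        = (\<Sum>l<n. w l * (\<Sum>l'<n. w l' * k (ss ! l) (ss ! l')))"
      by (simp add: sum_distrib_left mult_ac)
    also have "\<dots> = (\<Sum>i<m. \<Sum>j<m. z i * z j * k (as ! i) (as ! j))"
      unfolding w_sum by (simp add: as(3) sum_distrib_left mult_ac)
    finally show ?thesis
      unfolding reg_obj_def 1 by (simp add: w_sum as(3))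
  qed
  then show ?thesis
    using post_var_is_min(1)[OF pd ss \<sigma>, of x w] z unfolding n_def as_def by simp
qed

text \<open>Averaging t noisy observations taken at x itself leaves an error variance of \<sigma>^2
  / t, and the optimal weights can only do better. The bound does not depend on
  \<open>k x x\<close>.\<close>

lemma varsigma2_le:
  assumes k: "k x x \<ge> 0" and \<sigma>: "\<sigma> > 0" and t: "t > 0"
  shows "varsigma2 k \<sigma> t x \<le> \<sigma>\<^sup>2 / real t"
proof -
  have psd: "0 \<le> (\<Sum>i<t. \<Sum>j<t. w i * w j * k x x)" for w :: "nat \<Rightarrow> real"
  proof -
    have "(\<Sum>i<t. \<Sum>j<t. w i * w j * k x x) = (\<Sum>i<t. w i)\<^sup>2 * k x x"
      by (simp only: power2_eq_square sum_product) (simp only: sum_distrib_right)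
    then show ?thesis using k by simp
  qed
  have "reg_obj (\<sigma>\<^sup>2) t (\<lambda>_ _. k x x) (\<lambda>_. k x x) (\<lambda>_. 1 / real t) = k x x - \<sigma>\<^sup>2 / real t"
    using t by (simp add: reg_obj_def power2_eq_square field_simps)
  moreover have "reg_obj (\<sigma>\<^sup>2) t (\<lambda>_ _. k x x) (\<lambda>_. k x x) (\<lambda>_. 1 / real t) \<le> k x x - varsigma2 k \<sigma> t x"
    using reg_form_is_max(1)[where v = "\<sigma>\<^sup>2" and b = "\<lambda>_. k x x" and w = "\<lambda>_. 1 / real t", OF psd] \<sigma>
    by (simp add: varsigma2_def split_def)
  ultimately show ?thesis by simp
qed

text \<open>The credible interval has half-width below \<epsilon>. If the posterior mean is at least
  h, the lower bound exceeds h - \<epsilon>; if it is at most h, the upper bound is below h +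
  \<epsilon>. One of the two cases always occurs.\<close>

lemma classified_if_small_var:
  assumes "x \<in> \<Omega>" "\<beta> > 0" "\<epsilon> > 0" "post_var k \<sigma> (map fst dat) x < \<epsilon>\<^sup>2 / \<beta>"
  shows "x \<in> HL_set k \<sigma> \<beta> h \<epsilon> \<Omega> dat"
proof -
  have "\<beta> * post_var k \<sigma> (map fst dat) x < \<epsilon>\<^sup>2"
    using assms by (simp add: field_simps)
  then have "sqrt \<beta> * sqrt (post_var k \<sigma> (map fst dat) x) < \<epsilon>"
    using assms(3) by (metis real_sqrt_mult real_less_rsqrt real_sqrt_less_iff real_sqrt_unique less_imp_le)
  then show ?thesis
    using assms(1) by (auto simp: HL_set_def H_set_def L_set_def lcb_def ucb_def)
qed

section \<open>Measurability of the posterior\<close>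

lemma borel_measurable_det:
  assumes "\<And>\<omega>. B \<omega> \<in> carrier_mat n n"
    and "\<And>i j. i < n \<Longrightarrow> j < n \<Longrightarrow> (\<lambda>\<omega>. B \<omega> $$ (i, j)) \<in> borel_measurable N"
  shows "(\<lambda>\<omega>. Determinant.det (B \<omega>) :: real) \<in> borel_measurable N"
  unfolding det_def'[OF assms(1)]
  by (intro borel_measurable_sum borel_measurable_times borel_measurable_const borel_measurable_prod assms(2))
    (auto simp: permutes_in_image)

text \<open>Elimination branches on pivots, so the adjugate formula is used instead: the form is a
  sum of products of vector entries and signed minors, divided by a determinant that does not vanish
  on the space.\<close>

lemma borel_measurable_reg_form:
  fixes A :: "'w \<Rightarrow> real Matrix.mat"
  assumes A: "\<And>\<omega>. A \<omega> \<in> carrier_mat n n" "\<And>i j. i < n \<Longrightarrow> j < n \<Longrightarrow> (\<lambda>\<omega>. A \<omega> $$ (i, j)) \<in> borel_measurable N"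
    and b: "\<And>\<omega>. b \<omega> \<in> carrier_vec n" "\<And>i. i < n \<Longrightarrow> (\<lambda>\<omega>. vec_index (b \<omega>) i) \<in> borel_measurable N"
    and b': "\<And>\<omega>. b' \<omega> \<in> carrier_vec n" "\<And>i. i < n \<Longrightarrow> (\<lambda>\<omega>. vec_index (b' \<omega>) i) \<in> borel_measurable N"
    and det: "\<And>\<omega>. \<omega> \<in> space N \<Longrightarrow> Determinant.det (A \<omega> + smult_mat v (one_mat n)) \<noteq> 0"
  shows "(\<lambda>\<omega>. reg_form v (A \<omega>) (b \<omega>) (b' \<omega>)) \<in> borel_measurable N"
proof -
  define B where "B \<omega> = A \<omega> + smult_mat v (one_mat n)" for \<omega>
  have B: "B \<omega> \<in> carrier_mat n n" for \<omega> using A(1) unfolding B_def by simp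
  have B_meas: "(\<lambda>\<omega>. B \<omega> $$ (i, j)) \<in> borel_measurable N" if "i < n" "j < n" for i j
    using that A(1)[THEN carrier_matD(1)] A(1)[THEN carrier_matD(2)] A(2)[OF that]
    unfolding B_def by simp
  have adj: "(\<lambda>\<omega>. adj_mat (B \<omega>) $$ (i, j)) \<in> borel_measurable N" if ij: "i < n" "j < n" for i j
  proof -
    have "(\<lambda>\<omega>. Determinant.det (mat_delete (B \<omega>) j i)) \<in> borel_measurable N"
    proof (rule borel_measurable_det[where n = "n - 1"])
      show "mat_delete (B \<omega>) j i \<in> carrier_mat (n - 1) (n - 1)" for \<omega>
        using mat_delete_carrier[OF B] .
      fix i' j' assume "i' < n - 1" "j' < n - 1"
      then show "(\<lambda>\<omega>. mat_delete (B \<omega>) j i $$ (i', j')) \<in> borel_measurable N"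
        using B[THEN carrier_matD(1)] B[THEN carrier_matD(2)] ij
        by (auto simp: mat_delete_def intro!: B_meas)
    qed
    then show ?thesis
      using ij B[THEN carrier_matD(1)] B[THEN carrier_matD(2)]
      by (simp add: adj_mat_def cofactor_def)
  qed
  have "reg_form v (A \<omega>) (b \<omega>) (b' \<omega>) =
      (\<Sum>i<n. vec_index (b \<omega>) i *
         (\<Sum>j<n. adj_mat (B \<omega>) $$ (i, j) / Determinant.det (B \<omega>) * vec_index (b' \<omega>) j))"
    if \<omega>: "\<omega> \<in> space N" for \<omega>
  proof -
    obtain X where X: "mat_inverse (B \<omega>) = Some X" "X \<in> carrier_mat n n"
      "X = (1 / Determinant.det (B \<omega>)) \<cdot>\<^sub>m adj_mat (B \<omega>)"
      using mat_inverse_eq_adj[OF B] det[OF \<omega>] unfolding B_def by metis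
    have X_index: "X $$ (i, j) = adj_mat (B \<omega>) $$ (i, j) / Determinant.det (B \<omega>)"
      if "i < n" "j < n" for i j
      using that carrier_matD[OF adj_mat(1)[OF B]] unfolding X(3) by simp
    show ?thesis
      using X(1,2) A(1)[THEN carrier_matD(1)] b(1)[THEN carrier_vecD] b'(1)[THEN carrier_vecD]
      by (simp add: reg_form_def B_def[symmetric] scalar_prod_def atLeast0LessThan X_index)
  qed
  moreover have "(\<lambda>\<omega>. Determinant.det (B \<omega>)) \<in> borel_measurable N"
    using B B_meas by (rule borel_measurable_det)
  ultimately show ?thesis
    using adj b(2) b'(2)
    by (subst measurable_cong[where g = "\<lambda>\<omega>. (\<Sum>i<n. vec_index (b \<omega>) i *
         (\<Sum>j<n. adj_mat (B \<omega>) $$ (i, j) / Determinant.det (B \<omega>) * vec_index (b' \<omega>) j))"]) auto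
qed

section \<open>The target probabilities and the kernel of the model\<close>

context lse_model
begin

text \<open>The weights \<kappa> i over all pairs (a, i) total 1, so this is an average of
  probabilities. The bound keeps the factors 1 - p t * q nonnegative later on.\<close>

lemma p_tilde_le_1:
  assumes \<kappa>: "\<And>i. i \<in> {1..K} \<Longrightarrow> \<kappa> i \<in> {0<..<1}" "real (card \<Omega>) * (\<Sum>i=1..K. \<kappa> i) = 1"
  shows "p_tilde D \<Omega> K c g \<theta> \<kappa> \<nu> x \<le> 1"
proof -
  have "p_tilde D \<Omega> K c g \<theta> \<kappa> \<nu> x \<le> (\<Sum>a\<in>\<Omega>. \<Sum>i=1..K. \<kappa> i * 1)"
    unfolding p_tilde_def
  proof (intro sum_mono mult_left_mono)
    fix a i assume ai: "a \<in> \<Omega>" "i \<in> {1..K}"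
    then interpret S: prob_space "S_law g (\<theta> a (c i))" using g_density by blast
    show "measure (S_law g (\<theta> a (c i))) (nbhd D x \<nu>) \<le> 1" by simp
    show "0 \<le> \<kappa> i" using \<kappa>(1)[OF ai(2)] by simp
  qed
  then show ?thesis using \<kappa>(2) by simp
qed

lemma p_tilde_pos:
  assumes \<kappa>: "\<And>i. i \<in> {1..K} \<Longrightarrow> \<kappa> i \<in> {0<..<1}"
    and reach: "\<exists>a\<in>\<Omega>. \<exists>i\<in>{1..K}. measure (S_law g (\<theta> a (c i))) (nbhd D x \<nu>) > 0"
  shows "p_tilde D \<Omega> K c g \<theta> \<kappa> \<nu> x > 0"
proof -
  obtain a i where ai: "a \<in> \<Omega>" "i \<in> {1..K}" "measure (S_law g (\<theta> a (c i))) (nbhd D x \<nu>) > 0"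
    using reach by blast
  have nonneg: "0 \<le> \<kappa> j * measure (S_law g (\<theta> b (c j))) (nbhd D x \<nu>)" if "j \<in> {1..K}" for b j
    using \<kappa>[OF that] by simp
  show ?thesis
    unfolding p_tilde_def
  proof (rule sum_pos2[OF Omega(1) ai(1)])
    show "0 < (\<Sum>i=1..K. \<kappa> i * measure (S_law g (\<theta> a (c i))) (nbhd D x \<nu>))"
      by (rule sum_pos2[of _ i]) (use ai \<kappa>[of i] nonneg in auto)
  qed (use nonneg in \<open>auto intro: sum_nonneg\<close>)
qed

lemma nbhd_borel: "nbhd D x \<eta> \<in> sets borel"
proof -
  have "nbhd D x \<eta> = D \<inter> ball x \<eta>"
    by (auto simp: nbhd_def dist_norm norm_minus_commute)
  then show ?thesis using D_borel by simp
qed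

lemma measurable_kernel:
  assumes "u \<in> N \<rightarrow>\<^sub>M restrict_space borel D" "v \<in> N \<rightarrow>\<^sub>M restrict_space borel D"
  shows "(\<lambda>\<omega>. k (u \<omega>) (v \<omega>)) \<in> borel_measurable N"
  using measurable_compose[OF measurable_Pair[OF assms] k_borel] by simp

lemma k_diag_nonneg:
  assumes "x \<in> D"
  shows "0 \<le> k x x"
  using pd_kernel_on_psd[OF k_pd, of "[x]" "\<lambda>_. 1"] assms by simp

lemma kmat_reg_det_nonzero:
  assumes "set ss \<subseteq> D"
  shows "Determinant.det (kmat k ss + smult_mat (\<sigma>\<^sup>2) (one_mat (length ss))) \<noteq> 0"
  unfolding kmat_def
  by (rule reg_mat_det_nonzero) (use pd_kernel_on_psd[OF k_pd assms] sigma_pos in auto)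

end

section \<open>Measurability of the data and of the stopping events\<close>

context lse_run
begin

text \<open>Numbers the evaluated points by their position in the data list: initial points occupy
  positions 0 to n0 - 1, and trial t has position n0 + t - 1.\<close>

definition pt :: "nat \<Rightarrow> 'w \<Rightarrow> 'a" where
  "pt i \<omega> = (if i < n0 then s0 i \<omega> else s (Suc (i - n0)) \<omega>)"

definition obs :: "nat \<Rightarrow> 'w \<Rightarrow> real" where
  "obs i \<omega> = f (pt i \<omega>) + (if i < n0 then e0 i \<omega> else e (Suc (i - n0)) \<omega>)"

lemma dat_eq:
  assumes "\<omega> \<in> space M"
  shows "dat t \<omega> = map (\<lambda>i. (pt i \<omega>, obs i \<omega>)) [0..<n0 + t]"
proof (induction t)
  case 0
  then show ?case using dat_0[OF assms] by (simp add: pt_def obs_def)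
next
  case (Suc t)
  then show ?case using dat_Suc[OF assms] by (simp add: pt_def obs_def)
qed

lemma F_mono: "i \<le> j \<Longrightarrow> A \<in> sets (F i) \<Longrightarrow> A \<in> sets (F j)"
  using sets_F_mono by blast

lemma F_sets_M: "A \<in> sets (F t) \<Longrightarrow> A \<in> sets M"
  using F_sub[of t] by (auto simp: subalgebra_def)

lemma measurable_F_mono: "i \<le> j \<Longrightarrow> u \<in> F i \<rightarrow>\<^sub>M N \<Longrightarrow> u \<in> F j \<rightarrow>\<^sub>M N"
  unfolding measurable_def space_F using F_mono[of i j] by blast

lemma s_measurable:
  assumes "1 \<le> t"
  shows "s t \<in> F t \<rightarrow>\<^sub>M borel" "\<omega> \<in> space M \<Longrightarrow> s t \<omega> \<in> D"
  using adapted[OF assms] by (auto simp: measurable_restrict_space2_iff space_F)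

lemma pt_measurable:
  assumes "i < n0 + t"
  shows "pt i \<in> F t \<rightarrow>\<^sub>M restrict_space borel D"
proof (cases "i < n0")
  case True
  have "s0 i \<in> F t \<rightarrow>\<^sub>M restrict_space borel D"
    by (rule measurable_F_mono[OF le0 conjunct1[OF initial_adapted[OF True]]])
  then show ?thesis using True by (simp add: pt_def[abs_def])
next
  case False
  then have "Suc (i - n0) \<le> t" using assms by simp
  moreover have "s (Suc (i - n0)) \<in> F (Suc (i - n0)) \<rightarrow>\<^sub>M restrict_space borel D"
    using adapted[of "Suc (i - n0)"] by simp
  ultimately have "s (Suc (i - n0)) \<in> F t \<rightarrow>\<^sub>M restrict_space borel D"
    by (rule measurable_F_mono)
  then show ?thesis using False by (simp add: pt_def[abs_def])
qed

lemma pt_in_D: "\<omega> \<in> space M \<Longrightarrow> pt i \<omega> \<in> D"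
  using measurable_space[OF pt_measurable[of i "Suc i"], of \<omega>] by (simp add: space_F space_restrict_space)

lemma obs_measurable:
  assumes "i < n0 + t"
  shows "obs i \<in> borel_measurable (F t)"
proof -
  have "(\<lambda>\<omega>. f (pt i \<omega>)) \<in> borel_measurable (F t)"
    using measurable_compose[OF pt_measurable[OF assms] f_borel] .
  moreover have "(\<lambda>\<omega>. if i < n0 then e0 i \<omega> else e (Suc (i - n0)) \<omega>) \<in> borel_measurable (F t)"
  proof (cases "i < n0")
    case True
    have "e0 i \<in> borel_measurable (F t)"
      by (rule measurable_F_mono[OF le0 conjunct2[OF initial_adapted[OF True]]])
    then show ?thesis using True by simp
  next
    case False
    then have "Suc (i - n0) \<le> t" using assms by simp
    moreover have "e (Suc (i - n0)) \<in> borel_measurable (F (Suc (i - n0)))"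
      using adapted[of "Suc (i - n0)"] by simp
    ultimately have "e (Suc (i - n0)) \<in> borel_measurable (F t)"
      by (rule measurable_F_mono)
    then show ?thesis using False by simp
  qed
  ultimately show ?thesis unfolding obs_def by simp
qed

text \<open>The data list after t trials always has length n0 + t, so at a fixed x the posterior is
  built from a \<open>reg_form\<close> of random matrices and vectors of fixed size with measurable
  entries.\<close>

lemma posterior_measurable:
  assumes x: "x \<in> D"
  shows "(\<lambda>\<omega>. post_mean k \<sigma> (dat t \<omega>) x) \<in> borel_measurable (F t)"
    and "(\<lambda>\<omega>. post_var k \<sigma> (map fst (dat t \<omega>)) x) \<in> borel_measurable (F t)"
proof -
  define n where "n = n0 + t"
  define ss where "ss \<omega> = map (\<lambda>i. pt i \<omega>) [0..<n]" for \<omega>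
  define ys where "ys \<omega> = map (\<lambda>i. obs i \<omega>) [0..<n]" for \<omega>
  have ss: "map fst (dat t \<omega>) = ss \<omega>" and ys: "map snd (dat t \<omega>) = ys \<omega>" if "\<omega> \<in> space (F t)" for \<omega>
    using dat_eq[of \<omega> t] that by (auto simp: ss_def ys_def n_def space_F o_def)
  have A: "kmat k (ss \<omega>) \<in> carrier_mat n n" for \<omega> by (simp add: kmat_def ss_def)
  have A_meas: "(\<lambda>\<omega>. kmat k (ss \<omega>) $$ (i, j)) \<in> borel_measurable (F t)" if "i < n" "j < n" for i j
    using that measurable_kernel[OF pt_measurable[of i t] pt_measurable[of j t]]
    by (simp add: kmat_def ss_def n_def)
  have b: "kvec k (ss \<omega>) x \<in> carrier_vec n" for \<omega> by (simp add: kvec_def ss_def)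
  have const: "(\<lambda>_. x) \<in> F t \<rightarrow>\<^sub>M restrict_space borel D"
    using x by (simp add: space_restrict_space)
  have b_meas: "(\<lambda>\<omega>. vec_index (kvec k (ss \<omega>) x) i) \<in> borel_measurable (F t)" if "i < n" for i
    using that measurable_kernel[OF pt_measurable[of i t] const] by (simp add: kvec_def ss_def n_def)
  have y: "vec_of_list (ys \<omega>) \<in> carrier_vec n" for \<omega>
    by (metis carrier_vec_dim_vec dim_vec_of_list length_map length_upt minus_nat.diff_0 ys_def)
  have y_meas: "(\<lambda>\<omega>. vec_index (vec_of_list (ys \<omega>)) i) \<in> borel_measurable (F t)" if "i < n" for i
    using that obs_measurable[of i t] by (simp add: ys_def n_def vec_of_list_index)
  have det: "Determinant.det (kmat k (ss \<omega>) + smult_mat (\<sigma>\<^sup>2) (one_mat n)) \<noteq> 0"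
    if "\<omega> \<in> space (F t)" for \<omega>
    using kmat_reg_det_nonzero[of "ss \<omega>"] that pt_in_D by (auto simp: ss_def space_F)
  have "(\<lambda>\<omega>. reg_form (\<sigma>\<^sup>2) (kmat k (ss \<omega>)) (kvec k (ss \<omega>) x) (vec_of_list (ys \<omega>))) \<in> borel_measurable (F t)"
    by (rule borel_measurable_reg_form[OF A A_meas b b_meas y y_meas det])
  then show "(\<lambda>\<omega>. post_mean k \<sigma> (dat t \<omega>) x) \<in> borel_measurable (F t)"
    by (subst measurable_cong[OF post_mean_def]) (simp add: ss ys cong: measurable_cong)
  have "(\<lambda>\<omega>. reg_form (\<sigma>\<^sup>2) (kmat k (ss \<omega>)) (kvec k (ss \<omega>) x) (kvec k (ss \<omega>) x)) \<in> borel_measurable (F t)"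
    by (rule borel_measurable_reg_form[OF A A_meas b b_meas b b_meas det])
  then have "(\<lambda>\<omega>. post_var k \<sigma> (ss \<omega>) x) \<in> borel_measurable (F t)"
    by (simp add: post_var_def post_cov_def)
  then show "(\<lambda>\<omega>. post_var k \<sigma> (map fst (dat t \<omega>)) x) \<in> borel_measurable (F t)"
    by (simp add: ss cong: measurable_cong)
qed

lemma U_empty_sets: "{\<omega> \<in> space M. U t \<omega> = {}} \<in> sets (F t)"
proof (cases "t = 0")
  case True
  then have "{\<omega> \<in> space M. U t \<omega> = {}} = {}" using U_0 Omega(2) by auto
  then show ?thesis by (simp only: sets.empty_sets)
next
  case False
  then have "{\<omega> \<in> space M. U t \<omega> = {}} =
      {\<omega> \<in> space (F t). \<forall>x\<in>\<Omega>. lcb k \<sigma> \<beta> (dat t \<omega>) x > h - \<epsilon> \<or> ucb k \<sigma> \<beta> (dat t \<omega>) x < h + \<epsilon>}"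
    using U_pos by (auto simp: space_F HL_set_def H_set_def L_set_def)
  also have "\<dots> \<in> sets (F t)"
  proof (rule sets.sets_Collect_finite_All[OF _ Omega(1)])
    fix x assume "x \<in> \<Omega>"
    then have [measurable]: "(\<lambda>\<omega>. post_mean k \<sigma> (dat t \<omega>) x) \<in> borel_measurable (F t)"
      "(\<lambda>\<omega>. post_var k \<sigma> (map fst (dat t \<omega>)) x) \<in> borel_measurable (F t)"
      using posterior_measurable Omega(3) by auto
    show "{\<omega> \<in> space (F t). lcb k \<sigma> \<beta> (dat t \<omega>) x > h - \<epsilon> \<or> ucb k \<sigma> \<beta> (dat t \<omega>) x < h + \<epsilon>} \<in> sets (F t)"
      unfolding lcb_def ucb_def by measurable
  qed
  finally show ?thesis .
qed

text \<open>Whether trial t + 1 takes place is decided by the information after trial t; hence the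
  index shift. This makes the event a legitimate conditioning event for \<open>draw\<close>.\<close>

lemma performed_sets: "performed M U (Suc t) \<in> sets (F t)"
proof -
  have "performed M U (Suc t) = {\<omega> \<in> space (F t). \<forall>j\<in>{..t}. U j \<omega> \<noteq> {}}"
    by (auto simp: performed_def space_F less_Suc_eq_le)
  also have "\<dots> \<in> sets (F t)"
  proof (rule sets.sets_Collect_finite_All)
    fix j assume "j \<in> {..t}"
    then have "{\<omega> \<in> space M. U j \<omega> = {}} \<in> sets (F t)"
      using F_mono[OF _ U_empty_sets] by simp
    then have "space (F t) - {\<omega> \<in> space M. U j \<omega> = {}} \<in> sets (F t)" by blast
    also have "space (F t) - {\<omega> \<in> space M. U j \<omega> = {}} = {\<omega> \<in> space (F t). U j \<omega> \<noteq> {}}"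
      unfolding space_F by blast
    finally show "{\<omega> \<in> space (F t). U j \<omega> \<noteq> {}} \<in> sets (F t)" .
  qed simp
  finally show ?thesis .
qed

lemma sample_sets:
  assumes "1 \<le> t" "V \<in> sets borel"
  shows "{\<omega> \<in> space M. s t \<omega> \<in> V} \<in> sets (F t)"
  using measurable_sets[OF s_measurable(1)[OF assms(1)] assms(2)]
  by (simp add: space_F vimage_def Int_def conj_commute)

end

section \<open>Hitting probabilities and completion\<close>

context lse_run
begin

text \<open>Split E by the value of \<open>C t\<close>: \<open>draw\<close> gives the part that
  explores with C t = (a, i) the probability prob E * p t * \<kappa> i, and \<open>sample\<close>
  multiplies it by the chance that the selected law lands in V. The contribution of exploitation is
  discarded, so only an inequality results.\<close>

lemma explore_prob_ge:
  assumes t: "1 \<le> t" and E: "E \<in> sets (F (t - 1))" "E \<subseteq> performed M U t" and V: "V \<in> sets borel"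
  shows "prob E * p t * (\<Sum>a\<in>\<Omega>. \<Sum>i=1..K. \<kappa> i * measure (S_law g (\<theta> a (c i))) V)
    \<le> prob {\<omega> \<in> E. s t \<omega> \<in> V}"
proof -
  \<comment> \<open>The part of E where trial t explores and draws q; it lies in \<open>G t\<close>,
    as \<open>sample\<close> requires.\<close>
  define Q where "Q q = {\<omega> \<in> E. r t \<omega> = True \<and> C t \<omega> = q}" for q
  have G: "subalgebra (G t) (F (t - 1))" "subalgebra (F t) (G t)" using G_sub[OF t] by auto
  have E_M: "E \<subseteq> space M" using E(2) by (auto simp: performed_def)
  have EG: "E \<in> sets (G t)" using E(1) G(1) by (auto simp: subalgebra_def)
  have space_G: "space (G t) = space M" using G(1) by (simp add: subalgebra_def space_F)
  have Q_G: "Q q \<in> sets (G t)" if "q \<in> \<Omega> \<times> {1..K}" for q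
  proof -
    have "r t -` {True} \<inter> space (G t) \<in> sets (G t)" "C t -` {q} \<inter> space (G t) \<in> sets (G t)"
      using adapted[OF t] that by (auto intro: measurable_sets)
    then have "E \<inter> (r t -` {True} \<inter> space (G t)) \<inter> (C t -` {q} \<inter> space (G t)) \<in> sets (G t)"
      using EG by auto
    also have "E \<inter> (r t -` {True} \<inter> space (G t)) \<inter> (C t -` {q} \<inter> space (G t)) = Q q"
      using E_M unfolding Q_def space_G by auto
    finally show ?thesis .
  qed
  have Q_E: "Q q \<subseteq> performed M U t" for q using E(2) by (auto simp: Q_def)
  have prob_Q: "prob {\<omega> \<in> Q (a, i). s t \<omega> \<in> V} = prob E * p t * (\<kappa> i * measure (S_law g (\<theta> a (c i))) V)"
    if ai: "a \<in> \<Omega>" "i \<in> {1..K}" for a i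
  proof -
    have sel: "sel t \<omega> = (a, i)" if "\<omega> \<in> Q (a, i)" for \<omega>
      using that explore[OF t, of \<omega>] Q_E by (auto simp: Q_def)
    have "{\<omega> \<in> Q (a, i). s t \<omega> \<in> V} = {\<omega> \<in> Q (a, i). sel t \<omega> = (a, i) \<and> s t \<omega> \<in> V}"
      using sel by auto
    moreover have "{\<omega> \<in> Q (a, i). sel t \<omega> = (a, i)} = Q (a, i)" using sel by auto
    moreover have "prob (Q (a, i)) = prob E * p t * \<kappa> i"
      using draw[OF t E ai, of True] p_range[OF t] by (simp add: Q_def)
    ultimately show ?thesis
      using sample[OF t Q_G[of "(a, i)"] Q_E ai V] ai by (simp add: mult_ac)
  qed
  have sV: "{\<omega> \<in> space M. s t \<omega> \<in> V} \<in> sets M" using sample_sets[OF t V] by (rule F_sets_M)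
  have QV: "{\<omega> \<in> Q q. s t \<omega> \<in> V} \<in> sets M" if "q \<in> \<Omega> \<times> {1..K}" for q
  proof -
    have "Q q \<in> sets M" using Q_G[OF that] G(2) F_sets_M by (auto simp: subalgebra_def)
    then have "Q q \<inter> {\<omega> \<in> space M. s t \<omega> \<in> V} \<in> sets M" using sV by blast
    also have "Q q \<inter> {\<omega> \<in> space M. s t \<omega> \<in> V} = {\<omega> \<in> Q q. s t \<omega> \<in> V}"
      using E_M by (auto simp: Q_def)
    finally show ?thesis .
  qed
  have EV: "{\<omega> \<in> E. s t \<omega> \<in> V} \<in> sets M"
  proof -
    have "E \<inter> {\<omega> \<in> space M. s t \<omega> \<in> V} \<in> sets M" using sV E(1) F_sets_M by blast
    also have "E \<inter> {\<omega> \<in> space M. s t \<omega> \<in> V} = {\<omega> \<in> E. s t \<omega> \<in> V}" using E_M by auto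
    finally show ?thesis .
  qed
  have "prob E * p t * (\<Sum>a\<in>\<Omega>. \<Sum>i=1..K. \<kappa> i * measure (S_law g (\<theta> a (c i))) V)
      = (\<Sum>q\<in>\<Omega> \<times> {1..K}. prob {\<omega> \<in> Q q. s t \<omega> \<in> V})"
    by (simp add: sum.cartesian_product' sum_distrib_left prob_Q)
  also have "\<dots> = prob (\<Union>q\<in>\<Omega> \<times> {1..K}. {\<omega> \<in> Q q. s t \<omega> \<in> V})"
    using QV Omega(1)
    by (intro finite_measure_finite_Union[symmetric]) (auto simp: disjoint_family_on_def Q_def)
  also have "\<dots> \<le> prob {\<omega> \<in> E. s t \<omega> \<in> V}"
    using EV by (intro finite_measure_mono) (auto simp: Q_def)
  finally show ?thesis .
qed

text \<open>Membership in \<open>performed M U (Suc m)\<close> means that the run has not completed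
  after trial m. This keeps the event where the laws of the next trial are prescribed; runs that
  have completed count as successes.\<close>

definition no_hit :: "'a set \<Rightarrow> nat \<Rightarrow> nat \<Rightarrow> 'w set" where
  "no_hit V n m = {\<omega> \<in> performed M U (Suc m). \<forall>t\<in>{n + 1..m}. s t \<omega> \<notin> V}"

lemma no_hit_sets:
  assumes "V \<in> sets borel"
  shows "no_hit V n m \<in> sets (F m)"
proof -
  have "no_hit V n m = performed M U (Suc m) \<inter> {\<omega> \<in> space (F m). \<forall>t\<in>{n + 1..m}. s t \<omega> \<notin> V}"
    by (auto simp: no_hit_def performed_def space_F)
  also have "\<dots> \<in> sets (F m)"
  proof (intro sets.Int performed_sets sets.sets_Collect_finite_All)
    fix t assume t: "t \<in> {n + 1..m}"
    then have "{\<omega> \<in> space M. s t \<omega> \<in> - V} \<in> sets (F m)"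
      using assms by (intro F_mono[OF _ sample_sets]) auto
    then show "{\<omega> \<in> space (F m). s t \<omega> \<notin> V} \<in> sets (F m)"
      by (simp add: space_F)
  qed simp
  finally show ?thesis .
qed

text \<open>Induction over the trials of the block: as long as the run continues without a hit,
  trial t hits with conditional probability at least p t * q, so it multiplies the bound by 1 - p t
  * q.\<close>

lemma prob_no_hit_le:
  assumes "n \<le> m"
    and q: "0 \<le> q" "q \<le> 1" "q \<le> p_tilde D \<Omega> K c g \<theta> \<kappa> \<nu> x"
  shows "prob (no_hit (nbhd D x \<nu>) n m) \<le> (\<Prod>t\<in>{n + 1..m}. 1 - p t * q)"
  using assms(1)
proof (induction m rule: dec_induct)
  case base
  then show ?case by simp
next
  case (step m)
  let ?V = "nbhd D x \<nu>"
  let ?E = "no_hit ?V n m"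
  let ?hit = "{\<omega> \<in> ?E. s (Suc m) \<omega> \<in> ?V}"
  have E: "?E \<in> sets (F m)" "?E \<in> sets M" "?E \<subseteq> performed M U (Suc m)"
    using no_hit_sets[OF nbhd_borel] F_sets_M[OF no_hit_sets[OF nbhd_borel]]
    by (blast, blast) (simp add: no_hit_def)
  have pm: "0 \<le> p (Suc m)" "p (Suc m) \<le> 1" using p_range[of "Suc m"] by auto
  have "prob ?E * p (Suc m) * q \<le> prob ?E * p (Suc m) * p_tilde D \<Omega> K c g \<theta> \<kappa> \<nu> x"
    using q pm by (intro mult_left_mono) auto
  also have "\<dots> \<le> prob ?hit"
    using explore_prob_ge[of "Suc m" ?E ?V] E nbhd_borel unfolding p_tilde_def by simp
  finally have hit: "prob ?E * p (Suc m) * q \<le> prob ?hit" .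
  have hit_eq: "?hit = ?E \<inter> {\<omega> \<in> space M. s (Suc m) \<omega> \<in> ?V}"
    by (auto simp: no_hit_def performed_def)
  have hit_sets: "?hit \<in> sets M"
    unfolding hit_eq using E(2) F_sets_M[OF sample_sets[OF _ nbhd_borel]] by (intro sets.Int) auto
  \<comment> \<open>Only an inclusion: besides missing the neighbourhood, the run must not complete
    at trial m + 1.\<close>
  have "no_hit ?V n (Suc m) \<subseteq> ?E - ?hit"
    using step(1) unfolding no_hit_def performed_def by auto
  then have "prob (no_hit ?V n (Suc m)) \<le> prob (?E - ?hit)"
    by (rule finite_measure_mono) (rule sets.Diff[OF E(2) hit_sets])
  also have "\<dots> = prob ?E - prob ?hit"
    by (rule finite_measure_Diff[OF E(2) hit_sets]) blast
  also have "\<dots> \<le> prob ?E * (1 - p (Suc m) * q)"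
    using hit by (simp add: algebra_simps)
  also have "\<dots> \<le> (\<Prod>t\<in>{n + 1..m}. 1 - p t * q) * (1 - p (Suc m) * q)"
    using step.IH q pm by (intro mult_right_mono) (auto simp: mult_le_one)
  also have "\<dots> = (\<Prod>t\<in>{n + 1..Suc m}. 1 - p t * q)"
    using step(1) by simp
  finally show ?case .
qed

text \<open>For each x the T hits form a subfamily of the data; all other data, the initial ones
  included, can only lower the variance. Different points may share hits.\<close>

lemma completed_if_hits:
  assumes \<omega>: "\<omega> \<in> space M" and t: "1 \<le> t" and \<epsilon>: "\<epsilon> > 0" and \<beta>: "\<beta> > 0"
    and T: "0 < T" "real T > 2 * \<beta> * \<sigma>\<^sup>2 / \<epsilon>\<^sup>2"
    and \<nu>: "\<forall>x\<in>\<Omega>. \<forall>as. length as = T \<and> set as \<subseteq> nbhd D x \<nu> \<longrightarrow>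
        \<bar>varsigma2 k \<sigma> T x - post_var k \<sigma> as x\<bar> < \<epsilon>\<^sup>2 / (2 * \<beta>)"
    and hits: "\<And>x. x \<in> \<Omega> \<Longrightarrow> \<exists>\<tau>. inj_on \<tau> {..<T} \<and> (\<forall>i<T. \<tau> i \<in> {1..t} \<and> s (\<tau> i) \<omega> \<in> nbhd D x \<nu>)"
  shows "U t \<omega> = {}"
proof -
  have "x \<in> HL_set k \<sigma> \<beta> h \<epsilon> \<Omega> (dat t \<omega>)" if x: "x \<in> \<Omega>" for x
  proof (rule classified_if_small_var[OF x \<beta> \<epsilon>])
    obtain \<tau> where \<tau>: "inj_on \<tau> {..<T}" "\<And>i. i < T \<Longrightarrow> \<tau> i \<in> {1..t}"
      "\<And>i. i < T \<Longrightarrow> s (\<tau> i) \<omega> \<in> nbhd D x \<nu>"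
      using hits[OF x] by blast
    define ss where "ss = map fst (dat t \<omega>)"
    have ss: "length ss = n0 + t" "\<And>i. i < n0 + t \<Longrightarrow> ss ! i = pt i \<omega>" "set ss \<subseteq> D"
      using dat_eq[OF \<omega>, of t] pt_in_D[OF \<omega>] by (auto simp: ss_def)
    \<comment> \<open>The list position of trial \<tau> i: initial data come first, and trials count
      from 1.\<close>
    define idx where "idx i = n0 + \<tau> i - 1" for i
    have idx: "inj_on idx {..<T}" "\<And>i. i < T \<Longrightarrow> idx i < length ss" "\<And>i. i < T \<Longrightarrow> ss ! idx i = s (\<tau> i) \<omega>"
    proof -
      show "idx i < length ss" "ss ! idx i = s (\<tau> i) \<omega>" if "i < T" for i
        using \<tau>(2)[OF that] ss by (auto simp: idx_def pt_def)
      show "inj_on idx {..<T}"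
      proof (rule inj_onI)
        fix i j assume ij: "i \<in> {..<T}" "j \<in> {..<T}" "idx i = idx j"
        then have "\<tau> i = \<tau> j" using \<tau>(2)[of i] \<tau>(2)[of j] by (auto simp: idx_def)
        then show "i = j" using \<tau>(1) ij by (auto dest: inj_onD)
      qed
    qed
    let ?as = "map (\<lambda>i. ss ! idx i) [0..<T]"
    have "\<bar>varsigma2 k \<sigma> T x - post_var k \<sigma> ?as x\<bar> < \<epsilon>\<^sup>2 / (2 * \<beta>)"
      using \<nu> x idx(3) \<tau>(3) by (auto simp: image_subset_iff)
    moreover have "varsigma2 k \<sigma> T x \<le> \<sigma>\<^sup>2 / real T"
      using x Omega(3) by (intro varsigma2_le k_diag_nonneg sigma_pos T(1)) auto
    \<comment> \<open>The lower bound on T, rearranged. It supplies one half of \<epsilon>^2 /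
      \<beta>; the choice of \<nu> supplies the other.\<close>
    moreover have "\<sigma>\<^sup>2 / real T < \<epsilon>\<^sup>2 / (2 * \<beta>)"
      using T \<epsilon> \<beta> by (simp add: field_simps)
    moreover have "post_var k \<sigma> ss x \<le> post_var k \<sigma> ?as x"
      by (rule post_var_subfamily_le[OF k_pd ss(3) sigma_pos idx(1,2)])
    moreover have "\<epsilon>\<^sup>2 / \<beta> = \<epsilon>\<^sup>2 / (2 * \<beta>) + \<epsilon>\<^sup>2 / (2 * \<beta>)" by (simp add: field_simps)
    ultimately show "post_var k \<sigma> (map fst (dat t \<omega>)) x < \<epsilon>\<^sup>2 / \<beta>"
      unfolding ss_def by linarith
  qed
  then show ?thesis using U_pos[OF \<omega> t] by auto
qed

end

section \<open>Existence of the blocks\<close>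

text \<open>By 1 - u \<le> exp (- u), the product is at most exp of -q times a block sum of p, and
  divergence makes block sums starting after n arbitrarily large.\<close>

lemma prod_one_minus_tendsto_0:
  fixes p :: "nat \<Rightarrow> real"
  assumes div: "filterlim (\<lambda>n. \<Sum>t=1..n. p t) at_top sequentially"
    and p: "\<And>t. 1 \<le> t \<Longrightarrow> p t \<in> {0..1}" and q: "0 < q" "q \<le> 1" and \<eta>: "\<eta> > 0"
  shows "\<exists>m>n. (\<Prod>t\<in>{n + 1..m}. 1 - p t * q) < \<eta>"
proof -
  define S where "S m = (\<Sum>t=1..m. p t)" for m
  \<comment> \<open>The threshold solves q * (S m - S n) \<ge> 1 - ln \<eta>; the surplus 1 yields
    the strict inequality.\<close>
  have "\<forall>\<^sub>F m in sequentially. S n + (1 - ln \<eta>) / q \<le> S m \<and> m > n"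
    using div unfolding S_def filterlim_at_top by (intro eventually_conj eventually_gt_at_top) auto
  then obtain m where m: "S n + (1 - ln \<eta>) / q \<le> S m" "m > n"
    using eventually_happens by fastforce
  have "S m = S n + (\<Sum>t\<in>{n + 1..m}. p t)"
    using m(2) sum.ub_add_nat[of 1 n p "m - n"] unfolding S_def by simp
  then have "1 - ln \<eta> \<le> q * (\<Sum>t\<in>{n + 1..m}. p t)"
    using m q by (simp add: field_simps)
  then have big: "- (q * (\<Sum>t\<in>{n + 1..m}. p t)) < ln \<eta>" by linarith
  have "(\<Prod>t\<in>{n + 1..m}. 1 - p t * q) \<le> (\<Prod>t\<in>{n + 1..m}. exp (- (p t * q)))"
  proof (rule prod_mono)
    fix t assume "t \<in> {n + 1..m}"
    then show "0 \<le> 1 - p t * q \<and> 1 - p t * q \<le> exp (- (p t * q))"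
      using p[of t] q exp_ge_add_one_self[of "- (p t * q)"] by (auto simp: mult_le_one)
  qed
  also have "\<dots> = exp (- (q * (\<Sum>t\<in>{n + 1..m}. p t)))"
    by (simp add: exp_sum[symmetric] sum_distrib_left sum_negf mult_ac)
  also have "\<dots> < exp (ln \<eta>)" using big by simp
  finally show ?thesis using m(2) \<eta> by auto
qed

lemma admissible_blocks_exist:
  assumes "\<And>n. \<exists>m>n. (\<Prod>t\<in>{n + 1..m}. 1 - p t * q) < \<delta> / real J"
  shows "\<exists>N. admissible_blocks p q \<delta> J N"
proof -
  obtain nxt where nxt: "\<And>n. nxt n > n" "\<And>n. (\<Prod>t\<in>{n + 1..nxt n}. 1 - p t * q) < \<delta> / real J"
    using assms by metis
  have "admissible_blocks p q \<delta> J (\<lambda>j. (nxt ^^ j) 0)"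
    unfolding admissible_blocks_def
  proof (intro conjI ballI)
    fix j assume "j \<in> {1..J}"
    then have j: "(nxt ^^ j) 0 = nxt ((nxt ^^ (j - 1)) 0)" by (cases j) auto
    show "(nxt ^^ (j - 1)) 0 < (nxt ^^ j) 0" using nxt(1) unfolding j .
    show "(\<Prod>t\<in>{(nxt ^^ (j - 1)) 0 + 1..(nxt ^^ j) 0}. 1 - p t * q) < \<delta> / real J"
      using nxt(2) unfolding j .
  qed simp
  then show ?thesis by blast
qed

lemma admissible_blocks_mono:
  assumes "admissible_blocks p q \<delta> J N" "i \<le> j" "j \<le> J"
  shows "N i \<le> N j"
  using assms(2,3)
proof (induction j rule: dec_induct)
  case (step j)
  then have "N j < N (Suc j)"
    using assms(1) unfolding admissible_blocks_def by (auto dest!: bspec[of _ _ "Suc j"])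
  then show ?case using step by simp
qed simp

lemma ex_completes_after_iff:
  "(\<exists>t\<le>n. completes_after U t \<omega>) \<longleftrightarrow> (\<exists>t\<le>n. U t \<omega> = {})"
proof
  assume "\<exists>t\<le>n. U t \<omega> = {}"
  then obtain t where t: "t \<le> n" "U t \<omega> = {}" by blast
  define t' where "t' = (LEAST t. U t \<omega> = {})"
  have "completes_after U t' \<omega>"
    unfolding completes_after_def t'_def using LeastI[of "\<lambda>t. U t \<omega> = {}", OF t(2)] not_less_Least by blast
  moreover have "t' \<le> n" using Least_le[of "\<lambda>t. U t \<omega> = {}", OF t(2)] t(1) unfolding t'_def by simp
  ultimately show "\<exists>t\<le>n. completes_after U t \<omega>" by blast
qed (auto simp: completes_after_def)

section \<open>The union bound over the blocks\<close>

context lse_run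
begin

lemma completion_prob_ge:
  assumes \<epsilon>: "\<epsilon> > 0" and \<beta>: "\<beta> > 0"
    and T: "0 < T" "real T > 2 * \<beta> * \<sigma>\<^sup>2 / \<epsilon>\<^sup>2"
    and \<nu>: "\<forall>x\<in>\<Omega>. \<forall>as. length as = T \<and> set as \<subseteq> nbhd D x \<nu> \<longrightarrow>
        \<bar>varsigma2 k \<sigma> T x - post_var k \<sigma> as x\<bar> < \<epsilon>\<^sup>2 / (2 * \<beta>)"
    and q: "0 \<le> q" "q \<le> 1" "\<And>x. x \<in> \<Omega> \<Longrightarrow> q \<le> p_tilde D \<Omega> K c g \<theta> \<kappa> \<nu> x"
    and N: "admissible_blocks p q \<delta> (card \<Omega> * T) N"
  shows "prob {\<omega> \<in> space M. \<exists>t\<le>N (card \<Omega> * T). completes_after U t \<omega>} \<ge> 1 - \<delta>"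
proof -
  define J where "J = card \<Omega> * T"
  have J: "J > 0" using Omega T(1) by (simp add: J_def card_gt_0_iff)
  obtain en where en: "bij_betw en {..<card \<Omega>} \<Omega>"
    using ex_bij_betw_nat_finite[OF Omega(1)] by (auto simp: atLeast0LessThan)
  \<comment> \<open>Blocks 1 to T go to the first point, the next T to the second, and so on; j - 1
    appears because blocks count from 1.\<close>
  define x where "x j = en ((j - 1) div T)" for j
  have x: "x j \<in> \<Omega>" if "j \<in> {1..J}" for j
  proof -
    have "j - 1 < card \<Omega> * T" using that by (auto simp: J_def)
    then have "(j - 1) div T < card \<Omega>" by (rule less_mult_imp_div_less)
    then show ?thesis using en unfolding x_def by (auto dest: bij_betwE)
  qed
  have N_less: "N (j - 1) < N j" and N_prod: "(\<Prod>t\<in>{N (j - 1) + 1..N j}. 1 - p t * q) < \<delta> / real J"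
    if "j \<in> {1..J}" for j
    using N that by (auto simp: admissible_blocks_def J_def)
  note N_mono = admissible_blocks_mono[OF N[folded J_def]]
  define E where "E j = no_hit (nbhd D (x j) \<nu>) (N (j - 1)) (N j)" for j
  have E_sets: "E j \<in> sets M" for j
    unfolding E_def by (rule F_sets_M[OF no_hit_sets[OF nbhd_borel]])
  have NJ: "N J \<ge> 1" using N_less[of J] J by simp
  \<comment> \<open>By contradiction: if no \<open>E j\<close> occurs although trial N J + 1 is
    performed, every block hits its point, so each point has T hits by time N J and
    \<open>U (N J)\<close> is empty.\<close>
  have cover: "performed M U (Suc (N J)) \<subseteq> (\<Union>j\<in>{1..J}. E j)"
  proof (rule ccontr)
    assume "\<not> ?thesis"
    then obtain \<omega> where \<omega>: "\<omega> \<in> performed M U (Suc (N J))" "\<And>j. j \<in> {1..J} \<Longrightarrow> \<omega> \<notin> E j"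
      by blast
    have \<omega>M: "\<omega> \<in> space M" using \<omega>(1) by (simp add: performed_def)
    have "\<exists>t\<in>{N (j - 1) + 1..N j}. s t \<omega> \<in> nbhd D (x j) \<nu>" if j: "j \<in> {1..J}" for j
    proof -
      have "\<omega> \<in> performed M U (Suc (N j))"
        using \<omega>(1) N_mono[of j J] j by (auto simp: performed_def)
      then show ?thesis using \<omega>(2)[OF j] by (auto simp: E_def no_hit_def)
    qed
    then obtain tm where tm: "\<And>j. j \<in> {1..J} \<Longrightarrow> tm j \<in> {N (j - 1) + 1..N j}"
      "\<And>j. j \<in> {1..J} \<Longrightarrow> s (tm j) \<omega> \<in> nbhd D (x j) \<nu>"
      by metis
    \<comment> \<open>Block i ends no later than trial N (j - 1), and block j begins after it, so
      hits in different blocks are different trials.\<close>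
    have tm_less: "tm i < tm j" if "i \<in> {1..J}" "j \<in> {1..J}" "i < j" for i j
    proof -
      have "i \<le> j - 1" "j - 1 \<le> J" using that by auto
      from N_mono[OF this] show ?thesis using tm(1)[OF that(1)] tm(1)[OF that(2)] by simp
    qed
    have "U (N J) \<omega> = {}"
    proof (rule completed_if_hits[OF \<omega>M NJ \<epsilon> \<beta> T \<nu>])
      fix y assume "y \<in> \<Omega>"
      then obtain m where m: "m < card \<Omega>" "en m = y"
        using en by (metis bij_betw_iff_bijections lessThan_iff)
      \<comment> \<open>Point number m owns the blocks m * T + 1 to (m + 1) * T.\<close>
      have block: "m * T + i + 1 \<in> {1..J}" "x (m * T + i + 1) = y" if "i < T" for i
      proof -
        have "m * T + i < Suc m * T" using that by simp
        also have "\<dots> \<le> J" using m(1) unfolding J_def by (intro mult_le_mono1) simp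
        finally show "m * T + i + 1 \<in> {1..J}" by simp
        show "x (m * T + i + 1) = y" using that m(2) by (simp add: x_def)
      qed
      have "inj_on (\<lambda>i. tm (m * T + i + 1)) {..<T}"
      proof (rule linorder_inj_onI')
        fix i j assume "i \<in> {..<T}" "j \<in> {..<T}" "i < j"
        then show "tm (m * T + i + 1) \<noteq> tm (m * T + j + 1)"
          using tm_less[OF block(1) block(1), of i j] by simp
      qed
      moreover have "tm (m * T + i + 1) \<in> {1..N J} \<and> s (tm (m * T + i + 1)) \<omega> \<in> nbhd D y \<nu>"
        if i: "i < T" for i
        using tm[OF block(1)[OF i]] block[OF i] N_mono[of "m * T + i + 1" J] by auto
      ultimately show "\<exists>\<tau>. inj_on \<tau> {..<T} \<and> (\<forall>i<T. \<tau> i \<in> {1..N J} \<and> s (\<tau> i) \<omega> \<in> nbhd D y \<nu>)"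
        by blast
    qed
    then show False using \<omega>(1) by (auto simp: performed_def)
  qed
  have "prob (performed M U (Suc (N J))) \<le> prob (\<Union>j\<in>{1..J}. E j)"
    using E_sets by (intro finite_measure_mono cover) auto
  also have "\<dots> \<le> (\<Sum>j\<in>{1..J}. prob (E j))"
    using E_sets by (intro finite_measure_subadditive_finite) auto
  also have "\<dots> \<le> (\<Sum>j\<in>{1..J}. \<delta> / real J)"
  proof (rule sum_mono)
    fix j assume j: "j \<in> {1..J}"
    have "prob (E j) \<le> (\<Prod>t\<in>{N (j - 1) + 1..N j}. 1 - p t * q)"
      unfolding E_def using N_less[OF j] q x[OF j] by (intro prob_no_hit_le) auto
    then show "prob (E j) \<le> \<delta> / real J" using N_prod[OF j] by simp
  qed
  also have "\<dots> = \<delta>" using J by simp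
  finally have "prob (performed M U (Suc (N J))) \<le> \<delta>" .
  \<comment> \<open>Failing to complete within N J trials is the same as performing trial N J +
    1.\<close>
  moreover have "{\<omega> \<in> space M. \<exists>t\<le>N J. completes_after U t \<omega>} = space M - performed M U (Suc (N J))"
    unfolding ex_completes_after_iff by (auto simp: performed_def less_Suc_eq_le)
  ultimately show ?thesis
    using prob_compl[OF F_sets_M[OF performed_sets]] unfolding J_def by simp
qed

end

section \<open>Assembly of the theorem\<close>

theorem theorem3:
  fixes D \<Omega> :: "'a::euclidean_space set"
    and f :: "'a \<Rightarrow> real"
    and k :: "'a \<Rightarrow> 'a \<Rightarrow> real"
    and \<sigma> h \<epsilon> \<beta> \<delta> \<nu> pstar :: real
    and K n0 T :: nat
    and c p \<kappa> :: "nat \<Rightarrow> real"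
    and g :: "'q \<Rightarrow> 'a \<Rightarrow> real"
    and \<theta> :: "'a \<Rightarrow> real \<Rightarrow> 'q"
    and M :: "'w measure"
    and F G :: "nat \<Rightarrow> 'w measure"
    and s0 s :: "nat \<Rightarrow> 'w \<Rightarrow> 'a"
    and e0 e :: "nat \<Rightarrow> 'w \<Rightarrow> real"
    and r :: "nat \<Rightarrow> 'w \<Rightarrow> bool"
    and C sel :: "nat \<Rightarrow> 'w \<Rightarrow> 'a \<times> nat"
    and dat :: "nat \<Rightarrow> 'w \<Rightarrow> ('a \<times> real) list"
    and U :: "nat \<Rightarrow> 'w \<Rightarrow> 'a set"
  assumes run: "lse_run D \<Omega> f k \<sigma> K c g \<theta> M F G h \<epsilon> \<beta> p \<kappa> n0 s0 e0 r C sel s e dat U"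
    and eps: "\<epsilon> > 0"
    and beta: "\<beta> > 0"
    and A1: "filterlim (\<lambda>n. \<Sum>t=1..n. p t) at_top sequentially"
    and A2: "\<forall>x\<in>\<Omega>. \<forall>\<eta>>0. \<exists>x'\<in>\<Omega>. \<exists>i\<in>{1..K}.
      measure (S_law g (\<theta> x' (c i))) (nbhd D x \<eta>) > 0"
    and A3: "\<forall>x\<in>\<Omega>. continuous (at (x, x) within D \<times> D) (\<lambda>(a, b). k a b)"
    and delta: "0 < \<delta>" "\<delta> < 1"
    and T: "T = (LEAST n::nat. 0 < n \<and> real n > 2 * \<beta> * \<sigma>\<^sup>2 / \<epsilon>\<^sup>2)"
    and nu: "\<nu> > 0"
      "\<forall>x\<in>\<Omega>. \<forall>as. length as = T \<and> set as \<subseteq> nbhd D x \<nu> \<longrightarrow>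
        \<bar>varsigma2 k \<sigma> T x - post_var k \<sigma> as x\<bar> < \<epsilon>\<^sup>2 / (2 * \<beta>)"
    and pstar: "pstar = Min (p_tilde D \<Omega> K c g \<theta> \<kappa> \<nu> ` \<Omega>)"
  shows "(\<forall>x\<in>\<Omega>. p_tilde D \<Omega> K c g \<theta> \<kappa> \<nu> x > 0) \<and>
    (\<exists>N. admissible_blocks p pstar \<delta> (card \<Omega> * T) N) \<and>
    (\<forall>N. admissible_blocks p pstar \<delta> (card \<Omega> * T) N \<longrightarrow>
      measure M {\<omega> \<in> space M. \<exists>t\<le>N (card \<Omega> * T). completes_after U t \<omega>} \<ge> 1 - \<delta>)"
proof -
  interpret lse_run D \<Omega> f k \<sigma> K c g \<theta> M F G h \<epsilon> \<beta> p \<kappa> n0 s0 e0 r C sel s e dat U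
    by (rule run)
  have pos: "p_tilde D \<Omega> K c g \<theta> \<kappa> \<nu> x > 0" if "x \<in> \<Omega>" for x
    using A2 that nu(1) by (intro p_tilde_pos kappa_range) auto
  have pstar_le: "pstar \<le> p_tilde D \<Omega> K c g \<theta> \<kappa> \<nu> x" if "x \<in> \<Omega>" for x
    using that Omega(1) unfolding pstar by simp
  \<comment> \<open>The minimum is attained, so it inherits positivity and the bound 1 from the
    values.\<close>
  have "pstar \<in> p_tilde D \<Omega> K c g \<theta> \<kappa> \<nu> ` \<Omega>"
    unfolding pstar using Omega by (intro Min_in) auto
  then have pstar01: "0 < pstar" "pstar \<le> 1"
    using pos p_tilde_le_1[OF kappa_range kappa_sum] by auto
  \<comment> \<open>Some integer exceeds the threshold, so the least one is attained and T has both
    defining properties.\<close>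
  obtain n :: nat where "real n > max 0 (2 * \<beta> * \<sigma>\<^sup>2 / \<epsilon>\<^sup>2)"
    using reals_Archimedean2 by blast
  then have "0 < n \<and> real n > 2 * \<beta> * \<sigma>\<^sup>2 / \<epsilon>\<^sup>2"
    unfolding max_less_iff_conj of_nat_0_less_iff .
  then have "0 < T \<and> real T > 2 * \<beta> * \<sigma>\<^sup>2 / \<epsilon>\<^sup>2"
    unfolding T by (rule LeastI)
  then have T': "0 < T" "real T > 2 * \<beta> * \<sigma>\<^sup>2 / \<epsilon>\<^sup>2" by auto
  have "\<delta> / real (card \<Omega> * T) > 0"
    using delta(1) T'(1) Omega by (simp add: card_gt_0_iff)
  then have "\<exists>N. admissible_blocks p pstar \<delta> (card \<Omega> * T) N"
    using pstar01 by (intro admissible_blocks_exist prod_one_minus_tendsto_0[OF A1 p_range]) auto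
  moreover have "measure M {\<omega> \<in> space M. \<exists>t\<le>N (card \<Omega> * T). completes_after U t \<omega>} \<ge> 1 - \<delta>"
    if "admissible_blocks p pstar \<delta> (card \<Omega> * T) N" for N
    using completion_prob_ge[OF eps beta T' nu(2) less_imp_le[OF pstar01(1)] pstar01(2) pstar_le that] .
  ultimately show ?thesis using pos by blast
qed

end
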